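(* Let $\lambda=(\lambda_n)$ be a frequency. If $L(\lambda)<\infty$, then $\mathcal{D}_\infty^{ext}(\lambda)$ is complete. The space $\mathcal{D}_\infty(\lambda)$ is a Banach space if one of the following conditions holds: 1) $\lambda$ is $\mathbf{Q}$-linearly independent; 2) $L(\lambda)=0$; 3) $\sigma_b^{ext}=\sigma_c$ and $L(\lambda)<\infty$. In particular, this holds for $\lambda$'s satisfying 3.1) $(BC)$; 3.2) $(LC)$ and $L(\lambda)<\infty$. Moreover, all of the stated conditions are not necessary for completeness (that is, none of them is necessary).
   Context: A frequency is a strictly increasing sequence $\lambda=(\lambda_n)_{n\in\mathbf{N}}$ of non-negative real numbers tending to $+\infty$ ($\mathbf{N}=\{1,2,\dots\}$). A $\lambda$-Dirichlet series is a formal sum $D=\sum_{n\ge 1} a_n e^{-\lambda_n s}$ with complex coefficients $a_n$ and complex variable $s$; it is somewhere convergent if it converges at some point of $\mathbf{C}$. $[Re>\sigma]=\{s\in\mathbf{C}: \mathrm{Re}\,s>\sigma\}$. A somewhere convergent $D$ converges on some half-plane $[Re>\sigma]$ to a holomorphic function. $\mathcal{D}_\infty^{ext}(\lambda)$ is the space of all somewhere convergent $\lambda$-Dirichlet series $D$ whose limit function has a (unique) holomorphic and bounded extension $f$ to $[Re>0]$; it is normed by $\|D\|_\infty:=\sup_{[Re>0]}|f(s)|$. $\mathcal{D}_\infty(\lambda)$ is the subspace of all $\lambda$-Dirichlet series which converge on $[Re>0]$ and define a bounded function there, with the same norm. $\sigma_c(D)=\inf\{\sigma\in\mathbf{R}: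 D$ converges on $[Re>\sigma]\}$ and, for somewhere convergent $D$, $\sigma_b^{ext}(D)=\inf\{\sigma\in\mathbf{R}:$ the limit function of $D$ allows a holomorphic and bounded extension to $[Re>\sigma]\}$. The equality $\sigma_b^{ext}=\sigma_c$, written without argument, means that $\sigma_b^{ext}(D)=\sigma_c(D)$ for all somewhere convergent $\lambda$-Dirichlet series $D$. $L(\lambda):=\limsup_{N\to\infty}\frac{\log N}{\lambda_N}$. $\lambda$ is $\mathbf{Q}$-linearly independent if $\sum q_n\lambda_n=0$ implies $q=0$ for all finite rational sequences $q=(q_n)$. Bohr's condition $(BC)$: there is $l=l(\lambda)>0$ such that for every $\delta>0$ there is $C>0$ such that for all $n\in\mathbf{N}$, $\lambda_{n+1}-\lambda_n\ge C e^{-(l+\delta)\lambda_n}$. Landau's condition $(LC)$: for every $\delta>0$ there is $C>0$ such that for all $n\in\mathbf{N}$, $\lambda_{n+1}-\lambda_n\ge C e^{-e^{\delta\lambda_n}}$.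
   Formalization: Under 3.1) and 3.2), "this holds" is stated as: D_∞(λ) is Banach, L(λ)<∞, and σ_c ≤ σ_b^ext for all somewhere convergent D; the equality σ_b^ext=σ_c itself fails for λ_n=log n, D=Σ(-1)^{n+1}n^{-s} (σ_c=0, σ_b^ext=1). *)

theory Defs
  imports "HOL-Analysis.Analysis"
begin

text \<open>
  Sequences indexed by \<open>1, 2, 3, \<dots>\<close> in the mathematics are indexed from \<open>0\<close> here: \<open>lam n\<close> is
  \<open>\<lambda>\<^sub>n\<^sub>+\<^sub>1\<close> and \<open>a n\<close> is \<open>a\<^sub>n\<^sub>+\<^sub>1\<close>. A formal Dirichlet series with a given frequency is identified
  with its coefficient sequence \<open>a :: nat \<Rightarrow> complex\<close>.
\<close>

definition frequency :: "(nat \<Rightarrow> real) \<Rightarrow> bool" where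
  "frequency lam \<longleftrightarrow>
     strict_mono lam \<and> (\<forall>n. 0 \<le> lam n) \<and> filterlim lam at_top sequentially"

definition half_plane :: "real \<Rightarrow> complex set" where
  "half_plane \<sigma> = {s. \<sigma> < Re s}"

definition dterm :: "(nat \<Rightarrow> real) \<Rightarrow> (nat \<Rightarrow> complex) \<Rightarrow> complex \<Rightarrow> nat \<Rightarrow> complex" where
  "dterm lam a s n = a n * exp (- of_real (lam n) * s)"

definition dconv :: "(nat \<Rightarrow> real) \<Rightarrow> (nat \<Rightarrow> complex) \<Rightarrow> complex \<Rightarrow> bool" where
  "dconv lam a s \<longleftrightarrow> summable (dterm lam a s)"

definition dsum :: "(nat \<Rightarrow> real) \<Rightarrow> (nat \<Rightarrow> complex) \<Rightarrow> complex \<Rightarrow> complex" where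
  "dsum lam a s = (\<Sum>n. dterm lam a s n)"

definition somewhere_convergent :: "(nat \<Rightarrow> real) \<Rightarrow> (nat \<Rightarrow> complex) \<Rightarrow> bool" where
  "somewhere_convergent lam a \<longleftrightarrow> (\<exists>s. dconv lam a s)"

definition sigma_c :: "(nat \<Rightarrow> real) \<Rightarrow> (nat \<Rightarrow> complex) \<Rightarrow> ereal" where
  "sigma_c lam a = Inf {ereal \<sigma> |\<sigma>. \<forall>s\<in>half_plane \<sigma>. dconv lam a s}"

text \<open>
  The limit function lives on the open half-plane of convergence. If \<open>\<sigma>\<close> is at least the abscissa
  of convergence, the following says that \<open>f\<close> is its restriction to \<open>half_plane \<sigma>\<close>; otherwise it
  says that \<open>f\<close> genuinely extends it.
\<close>

definition bounded_extension ::
    "(nat \<Rightarrow> real) \<Rightarrow> (nat \<Rightarrow> complex) \<Rightarrow> real \<Rightarrow> (complex \<Rightarrow> complex) \<Rightarrow> bool" where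
  "bounded_extension lam a \<sigma> f \<longleftrightarrow>
     f holomorphic_on half_plane \<sigma> \<and> bounded (f ` half_plane \<sigma>) \<and>
     (\<forall>s\<in>half_plane \<sigma>. sigma_c lam a < ereal (Re s) \<longrightarrow> f s = dsum lam a s)"

definition sigma_b_ext :: "(nat \<Rightarrow> real) \<Rightarrow> (nat \<Rightarrow> complex) \<Rightarrow> ereal" where
  "sigma_b_ext lam a = Inf {ereal \<sigma> |\<sigma>. \<exists>f. bounded_extension lam a \<sigma> f}"

definition D_infty_ext :: "(nat \<Rightarrow> real) \<Rightarrow> (nat \<Rightarrow> complex) set" where
  "D_infty_ext lam =
     {a. somewhere_convergent lam a \<and> (\<exists>f. bounded_extension lam a 0 f)}"

definition D_infty :: "(nat \<Rightarrow> real) \<Rightarrow> (nat \<Rightarrow> complex) set" where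
  "D_infty lam =
     {a. (\<forall>s\<in>half_plane 0. dconv lam a s) \<and> bounded (dsum lam a ` half_plane 0)}"

text \<open>
  By the identity theorem the extension is unique on \<open>half_plane 0\<close>, so the choice does not
  influence the value of the norm.
\<close>

definition D_norm :: "(nat \<Rightarrow> real) \<Rightarrow> (nat \<Rightarrow> complex) \<Rightarrow> real" where
  "D_norm lam a =
     (SUP s\<in>half_plane 0. cmod ((SOME f. bounded_extension lam a 0 f) s))"

definition complex_normed_space_on ::
    "(nat \<Rightarrow> complex) set \<Rightarrow> ((nat \<Rightarrow> complex) \<Rightarrow> real) \<Rightarrow> bool" where
  "complex_normed_space_on V N \<longleftrightarrow>
     (\<lambda>n. 0) \<in> V \<and>
     (\<forall>a\<in>V. \<forall>b\<in>V. (\<lambda>n. a n + b n) \<in> V \<and> N (\<lambda>n. a n + b n) \<le> N a + N b) \<and>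
     (\<forall>c. \<forall>a\<in>V. (\<lambda>n. c * a n) \<in> V \<and> N (\<lambda>n. c * a n) = cmod c * N a) \<and>
     (\<forall>a\<in>V. 0 \<le> N a \<and> (N a = 0 \<longleftrightarrow> a = (\<lambda>n. 0)))"

text \<open>
  The locale \<open>Metric_space\<close> requires distances to be symmetric and nonnegative even outside the
  carrier, where \<open>N\<close> is arbitrary; hence the default value \<open>0\<close>.
\<close>

definition norm_dist ::
    "(nat \<Rightarrow> complex) set \<Rightarrow> ((nat \<Rightarrow> complex) \<Rightarrow> real) \<Rightarrow>
     (nat \<Rightarrow> complex) \<Rightarrow> (nat \<Rightarrow> complex) \<Rightarrow> real" where
  "norm_dist V N a b = (if a \<in> V \<and> b \<in> V then N (\<lambda>n. a n - b n) else 0)"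

definition banach_space_on ::
    "(nat \<Rightarrow> complex) set \<Rightarrow> ((nat \<Rightarrow> complex) \<Rightarrow> real) \<Rightarrow> bool" where
  "banach_space_on V N \<longleftrightarrow>
     complex_normed_space_on V N \<and> Metric_space.mcomplete V (norm_dist V N)"

text \<open>
  The quotient for \<open>n = 0\<close> has numerator \<open>ln 1 = 0\<close>, and it is the only one whose denominator may
  vanish.
\<close>

definition L_freq :: "(nat \<Rightarrow> real) \<Rightarrow> ereal" where
  "L_freq lam = limsup (\<lambda>n. ereal (ln (real (Suc n)) / lam n))"

definition Q_lin_independent :: "(nat \<Rightarrow> real) \<Rightarrow> bool" where
  "Q_lin_independent lam \<longleftrightarrow>
     (\<forall>N (q :: nat \<Rightarrow> rat). (\<Sum>n<N. of_rat (q n) * lam n) = 0 \<longrightarrow> (\<forall>n<N. q n = 0))"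

definition bohr_condition :: "(nat \<Rightarrow> real) \<Rightarrow> bool" where
  "bohr_condition lam \<longleftrightarrow>
     (\<exists>l>0. \<forall>\<delta>>0. \<exists>C>0. \<forall>n. lam (Suc n) - lam n \<ge> C * exp (- (l + \<delta>) * lam n))"

definition landau_condition :: "(nat \<Rightarrow> real) \<Rightarrow> bool" where
  "landau_condition lam \<longleftrightarrow>
     (\<forall>\<delta>>0. \<exists>C>0. \<forall>n. lam (Suc n) - lam n \<ge> C * exp (- exp (\<delta> * lam n)))"

definition abscissas_agree :: "(nat \<Rightarrow> real) \<Rightarrow> bool" where
  "abscissas_agree lam \<longleftrightarrow>
     (\<forall>a. somewhere_convergent lam a \<longrightarrow> sigma_b_ext lam a = sigma_c lam a)"

text \<open>
  One half of \<open>abscissas_agree\<close>: a bounded holomorphic extension to a half-plane forces convergence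
  there. The other half can fail even under Bohr's condition: for \<open>lam n = ln (n + 1)\<close> and
  \<open>a n = (- 1) ^ n\<close> the abscissa of convergence is \<open>0\<close>, but the sum is unbounded on every
  half-plane \<open>half_plane \<sigma>\<close> with \<open>\<sigma> < 1\<close>.
\<close>

definition extension_forces_convergence :: "(nat \<Rightarrow> real) \<Rightarrow> bool" where
  "extension_forces_convergence lam \<longleftrightarrow>
     (\<forall>a. somewhere_convergent lam a \<longrightarrow> sigma_c lam a \<le> sigma_b_ext lam a)"

definition ext_complete :: "(nat \<Rightarrow> real) \<Rightarrow> bool" where
  "ext_complete lam \<longleftrightarrow> banach_space_on (D_infty_ext lam) (D_norm lam)"

definition D_infty_banach :: "(nat \<Rightarrow> real) \<Rightarrow> bool" where
  "D_infty_banach lam \<longleftrightarrow> banach_space_on (D_infty lam) (D_norm lam)"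

end

theory Submission
  imports Defs "HOL-Complex_Analysis.Complex_Analysis" "HOL-Real_Asymp.Real_Asymp"
begin

text \<open>
  Integrating the limit function \<open>f\<close> along a vertical line \<open>Re z = 1 / x\<close> against the kernel
  \<open>e\<^bsup>xz\<^esup> (1 - e\<^bsup>-Bz\<^esup>)\<^sup>2 / (B\<^sup>2 z\<^sup>3)\<close> produces a Dirichlet polynomial whose weights are \<open>1\<close> on
  frequencies up to \<open>x - 2 B\<close> and \<open>0\<close> from \<open>x\<close> on. It is bounded by \<open>\<parallel>f\<parallel>\<close> times the \<open>L\<^sup>1\<close> norm of the
  kernel, which is \<open>O (ln (1 + 16 x\<^sup>2 / B\<^sup>2))\<close>. With \<open>B = x / 4\<close> the bound is uniform in \<open>x\<close>: mean values
  then bound every coefficient by a constant times \<open>\<parallel>f\<parallel>\<close>, and under \<open>\<rat>\<close>-independence Kronecker's theorem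
  bounds even \<open>\<Sum>\<bar>a\<^sub>n\<bar>\<close>. Such estimates make Cauchy sequences converge in a weighted \<open>\<ell>\<^sup>1\<close> space of
  coefficients, hence completeness. With \<open>B\<close> half the gap after \<open>\<lambda>\<^sub>N\<close> the weighted sum is the \<open>N\<close>-th
  partial sum, which under Landau's condition is therefore \<open>O (e\<^bsup>\<delta>\<lambda>\<^sub>N\<^esup>)\<close> for every \<open>\<delta> > 0\<close>.
  A \<open>\<rat>\<close>-independent frequency with \<open>L = \<infinity>\<close> and the frequency \<open>\<lambda>\<^sub>n = n\<close> show that no condition is necessary.
\<close>

text \<open>The obstacle is that nothing is known about the series near Re s = 0, where only the
  extension f is bounded. The kernel integral of f is therefore identified with a Dirichlet
  polynomial far to the right, where the series converges, and the identity theorem carries this to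
  Re s > 0. Even far to the right absolute convergence may fail when L = \<infinity>: the remainder
  of the series on a vertical line is only known to be O(\<epsilon> (1 + |t|)), so the kernel needs
  a finite first moment, which the cubic denominator provides. The double zero of (1 - e^{-Bz})^2
  leaves a simple pole at 0 with residue 1 and keeps the kernel of order 1/|z| until |z| is about
  1/B. Starting from Re z = 1/x this costs a logarithm of x/B and no power. That logarithm is why
  Landau's condition fits: it turns a gap of size e^{-e^{\<delta>\<lambda>}} into a factor
  e^{\<delta>\<lambda>}.\<close>

lemma half_plane_iff [simp]: "s \<in> half_plane \<sigma> \<longleftrightarrow> \<sigma> < Re s"
  by (simp add: half_plane_def)

lemma half_plane_mono: "\<sigma> \<le> \<tau> \<Longrightarrow> half_plane \<tau> \<subseteq> half_plane \<sigma>"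
  by (auto simp: half_plane_def)

lemma open_half_plane: "open (half_plane \<sigma>)"
  unfolding half_plane_def by (rule open_halfspace_Re_gt)

lemma convex_half_plane: "convex (half_plane \<sigma>)"
  unfolding half_plane_def by (rule convex_halfspace_Re_gt)

lemma half_plane_nonempty: "half_plane \<sigma> \<noteq> {}"
proof -
  have "of_real (\<sigma> + 1) \<in> half_plane \<sigma>" by simp
  then show ?thesis by blast
qed

text \<open>The form in which the identity theorem is used throughout: agreement is known only far
  to the right.\<close>

lemma half_plane_identity:
  assumes "f holomorphic_on half_plane \<sigma>" "g holomorphic_on half_plane \<sigma>"
    and "\<And>s. \<tau> < Re s \<Longrightarrow> f s = g s" and "\<sigma> < Re s"
  shows "f s = g s"
proof (rule analytic_continuation_open[where s = "half_plane (max \<sigma> \<tau>)" and s' = "half_plane \<sigma>"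
        and f = f and g = g])
  show "connected (half_plane \<sigma>)" by (simp add: convex_half_plane convex_connected)
qed (use assms half_plane_nonempty half_plane_mono in \<open>auto simp: open_half_plane\<close>)

lemma dterm_eq: "dterm lam a s n = a n * exp (- (of_real (lam n) * s))"
  by (simp add: dterm_def)

lemma dterm_shift:
  "dterm lam a (s + s0) n = dterm lam a s0 n * exp (- (of_real (lam n) * s))"
  by (simp add: dterm_eq exp_add exp_diff exp_minus ring_distribs field_simps)

lemma frequency_mono: "frequency lam \<Longrightarrow> mono lam"
  by (simp add: frequency_def strict_mono_mono)

subsection \<open>Abel summation\<close>

text \<open>The increment is the integral of -u e^{-vu} over [p, q], and e^{\<delta>p} \<le>
  e^{\<delta>v} there, so the product is at most |u| times the integral of e^{-v (Re u - \<delta>)}.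
  In evaluated form the right-hand side telescopes along an increasing sequence.\<close>

lemma exp_increment_bound:
  fixes u :: complex
  assumes "0 \<le> \<delta>" "\<delta> < Re u" "p \<le> q"
  shows "exp (\<delta> * p) * cmod (exp (- (of_real q * u)) - exp (- (of_real p * u)))
     \<le> cmod u / (Re u - \<delta>) * (exp (- (p * (Re u - \<delta>))) - exp (- (q * (Re u - \<delta>))))"
proof (cases "p = q")
  case False
  with assms have "p < q" by simp
  define \<phi> where "\<phi> = (\<lambda>v. - (cmod u / (Re u - \<delta>) * exp (- (\<delta> * p)) * exp (- (v * (Re u - \<delta>)))))"
  define F where "F = (\<lambda>v. exp (- (of_real v * u)))"
  have "cmod (F q - F p) \<le> \<phi> q - \<phi> p"
  proof (rule differentiable_bound_general[OF \<open>p < q\<close>])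
    show "continuous_on {p..q} F" "continuous_on {p..q} \<phi>"
      unfolding F_def \<phi>_def using assms by (auto intro!: continuous_intros)
    show "(F has_vector_derivative (- u * exp (- (of_real x * u)))) (at x)" for x
    proof -
      have "((\<lambda>z. exp (- (z * u))) has_field_derivative (- u * exp (- (of_real x * u)))) (at (of_real x))"
        by (auto intro!: derivative_eq_intros)
      from has_vector_derivative_real_field[OF this] show ?thesis by (simp add: F_def)
    qed
    show "(\<phi> has_vector_derivative (cmod u * exp (- (\<delta> * p)) * exp (- (x * (Re u - \<delta>))))) (at x)" for x
    proof -
      have r: "Re u - \<delta> \<noteq> 0" using assms by simp
      then show ?thesis
        unfolding \<phi>_def has_real_derivative_iff_has_vector_derivative[symmetric]
        by (auto intro!: derivative_eq_intros simp: divide_simps) (simp add: algebra_simps)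
    qed
    show "cmod (- u * exp (- (of_real x * u))) \<le> cmod u * exp (- (\<delta> * p)) * exp (- (x * (Re u - \<delta>)))"
      if "p < x" "x < q" for x
    proof -
      have "- (x * Re u) \<le> - (\<delta> * p) - x * (Re u - \<delta>)"
        using mult_left_mono[of p x \<delta>] that assms by (simp add: algebra_simps)
      then have "exp (- (x * Re u)) \<le> exp (- (\<delta> * p)) * exp (- (x * (Re u - \<delta>)))"
        by (simp flip: exp_add)
      then show ?thesis by (simp add: norm_mult mult_left_mono mult.assoc)
    qed
  qed
  then have "exp (\<delta> * p) * cmod (F q - F p) \<le> exp (\<delta> * p) * (\<phi> q - \<phi> p)"
    by (simp add: mult_left_mono)
  also have "\<dots> = (exp (\<delta> * p) * exp (- (\<delta> * p))) *
      (cmod u / (Re u - \<delta>) * (exp (- (p * (Re u - \<delta>))) - exp (- (q * (Re u - \<delta>)))))"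
    unfolding \<phi>_def by (simp only: algebra_simps)
  also have "exp (\<delta> * p) * exp (- (\<delta> * p)) = 1" by (simp flip: exp_add)
  finally show ?thesis by (simp add: F_def)
qed simp

lemma summation_by_parts:
  fixes b w :: "nat \<Rightarrow> 'a::comm_ring"
  shows "(\<Sum>n<Suc N. b n * w n) =
    (\<Sum>i\<le>N. b i) * w N - (\<Sum>n<N. (\<Sum>i\<le>n. b i) * (w (Suc n) - w n))"
  by (induction N) (simp_all add: algebra_simps)

text \<open>Summation by parts moves the growth of the partial sums onto the increments of
  e^{-\<lambda>u}, whose bounds telescope. With \<delta> = 0 this gives remainder estimates; with
  \<delta> > 0 it turns the growth of partial sums under Landau's condition into
  convergence.\<close>

lemma abel_dirichlet:
  fixes b :: "nat \<Rightarrow> complex"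
  assumes lam: "mono lam" "\<And>n. 0 \<le> lam n" "filterlim lam at_top sequentially"
    and b: "\<And>n. cmod (\<Sum>i\<le>n. b i) \<le> C * exp (\<delta> * lam n)"
    and \<delta>: "0 \<le> \<delta>" "\<delta> < Re u"
  shows "summable (\<lambda>n. b n * exp (- (of_real (lam n) * u)))"
    and "cmod (\<Sum>n. b n * exp (- (of_real (lam n) * u))) \<le> C * cmod u / (Re u - \<delta>)"
proof -
  define w where "w = (\<lambda>n. exp (- (of_real (lam n) * u)))"
  define B where "B = (\<lambda>n. \<Sum>i\<le>n. b i)"
  define e where "e = (\<lambda>n. exp (- (lam n * (Re u - \<delta>))))"
  define K where "K = C * cmod u / (Re u - \<delta>)"
  have "0 \<le> C * exp (\<delta> * lam 0)" using b[of 0] norm_ge_zero order_trans by blast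
  then have C: "0 \<le> C" by (simp add: zero_le_mult_iff)
  then have K: "0 \<le> K" using \<delta> by (simp add: K_def)
  have lin: "filterlim (\<lambda>n. lam n * (Re u - \<delta>)) at_top sequentially"
    using \<delta> lam(3) by (subst mult.commute, intro filterlim_tendsto_pos_mult_at_top[OF tendsto_const]) auto
  have e0: "e \<longlonglongrightarrow> 0"
    unfolding e_def by (rule filterlim_compose[OF exp_at_bot]) (use lin in \<open>simp add: filterlim_uminus_at_top\<close>)
  have t: "cmod (B n * (w (Suc n) - w n)) \<le> K * (e n - e (Suc n))" for n
  proof -
    have "cmod (B n * (w (Suc n) - w n)) \<le> C * exp (\<delta> * lam n) * cmod (w (Suc n) - w n)"
      unfolding norm_mult B_def by (intro mult_right_mono b) auto
    also have "\<dots> = C * (exp (\<delta> * lam n) * cmod (w (Suc n) - w n))" by simp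
    also have "\<dots> \<le> C * (cmod u / (Re u - \<delta>) * (e n - e (Suc n)))"
      unfolding w_def e_def using monoD[OF lam(1), of n "Suc n"] \<delta> C
      by (intro mult_left_mono exp_increment_bound) auto
    finally show ?thesis by (simp add: K_def)
  qed
  have tel: "(\<lambda>n. e n - e (Suc n)) sums (e 0 - 0)" by (rule telescope_sums'[OF e0])
  have sumK: "(\<lambda>n. K * (e n - e (Suc n))) sums (K * e 0)" using sums_mult[OF tel, of K] by simp
  have sn: "summable (\<lambda>n. cmod (B n * (w (Suc n) - w n)))"
    by (rule summable_comparison_test'[OF sums_summable[OF sumK]]) (use t in auto)
  have "(\<lambda>n. B n * w n) \<longlonglongrightarrow> 0"
  proof (rule Lim_null_comparison)
    show "(\<lambda>n. C * e n) \<longlonglongrightarrow> 0" using tendsto_mult_left[OF e0, of C] by simp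
    have "cmod (B n * w n) \<le> C * e n" for n
    proof -
      have "cmod (B n * w n) \<le> C * exp (\<delta> * lam n) * cmod (w n)"
        unfolding norm_mult B_def by (intro mult_right_mono b) auto
      also have "\<dots> = C * e n"
        by (simp add: w_def e_def algebra_simps flip: exp_add)
      finally show ?thesis .
    qed
    then show "\<forall>\<^sub>F n in sequentially. cmod (B n * w n) \<le> C * e n" by simp
  qed
  moreover have "(\<lambda>N. \<Sum>n<N. B n * (w (Suc n) - w n)) \<longlonglongrightarrow> (\<Sum>n. B n * (w (Suc n) - w n))"
    using summable_norm_cancel[OF sn] by (rule summable_LIMSEQ)
  ultimately have "(\<lambda>N. \<Sum>n<Suc N. b n * w n) \<longlonglongrightarrow> 0 - (\<Sum>n. B n * (w (Suc n) - w n))"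
    unfolding summation_by_parts B_def by (rule tendsto_diff)
  then have s: "(\<lambda>n. b n * w n) sums - (\<Sum>n. B n * (w (Suc n) - w n))"
    using LIMSEQ_imp_Suc[of "\<lambda>N. \<Sum>n<N. b n * w n"] by (simp add: sums_def del: sum.lessThan_Suc)
  then show "summable (\<lambda>n. b n * exp (- (of_real (lam n) * u)))"
    unfolding w_def by (rule sums_summable)
  have "cmod (\<Sum>n. B n * (w (Suc n) - w n)) \<le> (\<Sum>n. cmod (B n * (w (Suc n) - w n)))"
    by (rule summable_norm[OF sn])
  also have "\<dots> \<le> (\<Sum>n. K * (e n - e (Suc n)))"
    by (rule suminf_le[OF t sn sums_summable[OF sumK]])
  also have "\<dots> = K * e 0" using sumK sums_unique by metis
  also have "\<dots> \<le> K" using K lam(2)[of 0] \<delta> by (simp add: e_def mult_left_le)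
  finally show "cmod (\<Sum>n. b n * exp (- (of_real (lam n) * u))) \<le> C * cmod u / (Re u - \<delta>)"
    using sums_unique[OF s, symmetric] by (simp add: K_def w_def)
qed

lemma dconv_of_partial_sums:
  assumes "frequency lam" and "0 \<le> \<delta>" "\<delta> < Re s"
    and "\<And>n. cmod (\<Sum>i\<le>n. a i) \<le> C * exp (\<delta> * lam n)"
  shows "dconv lam a s"
  unfolding dconv_def dterm_eq
  by (rule abel_dirichlet(1)[where C = C and \<delta> = \<delta>]) (use assms in \<open>auto simp: frequency_def strict_mono_mono\<close>)

section \<open>Half-planes of convergence\<close>

text \<open>One Cauchy index at \<open>s0\<close> serves every s to its right. The price is the
  factor |s - s0|, a linear growth along vertical lines that has to be absorbed by any kernel
  integrated against the remainder.\<close>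

lemma dconv_tail_bound:
  assumes fr: "frequency lam" and conv: "dconv lam a s0" and "0 < \<epsilon>"
  shows "\<exists>m0. \<forall>m\<ge>m0. \<forall>s. Re s0 < Re s \<longrightarrow>
    dconv lam a s \<and> cmod (dsum lam a s - (\<Sum>n<m. dterm lam a s n)) \<le> \<epsilon> * cmod (s - s0) / (Re s - Re s0)"
proof -
  obtain m0 where m0: "\<And>m n. m \<ge> m0 \<Longrightarrow> cmod (\<Sum>i\<in>{m..<n}. dterm lam a s0 i) < \<epsilon>"
    using conv \<open>0 < \<epsilon>\<close> unfolding dconv_def summable_Cauchy by meson
  show ?thesis
  proof (intro exI allI impI)
    fix m s assume "m0 \<le> m" "Re s0 < Re s"
    define u where "u = s - s0"
    have s: "s = u + s0" by (simp add: u_def)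
    note abel = abel_dirichlet[of "\<lambda>n. lam (n + m)" "\<lambda>n. dterm lam a s0 (n + m)" \<epsilon> 0 u]
    have part: "cmod (\<Sum>i\<le>n. dterm lam a s0 (i + m)) \<le> \<epsilon> * exp (0 * lam (n + m))" for n
    proof -
      have "(\<Sum>i\<le>n. dterm lam a s0 (i + m)) = (\<Sum>i\<in>{m..<m + Suc n}. dterm lam a s0 i)"
        using sum.shift_bounds_nat_ivl[of "dterm lam a s0" 0 m "Suc n"]
        by (simp add: atLeast0LessThan lessThan_Suc_atMost add.commute)
      with m0[OF \<open>m0 \<le> m\<close>, of "m + Suc n"] show ?thesis by simp
    qed
    have shift: "filterlim (\<lambda>n. lam (n + m)) at_top sequentially"
      using fr filterlim_compose[OF _ filterlim_add_const_nat_at_top] by (auto simp: frequency_def)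
    have u: "0 < Re u" using \<open>Re s0 < Re s\<close> by (simp add: u_def)
    have 1: "summable (\<lambda>n. dterm lam a s (n + m))"
      and 2: "cmod (\<Sum>n. dterm lam a s (n + m)) \<le> \<epsilon> * cmod u / Re u"
      using abel(1)[OF _ _ shift part] abel(2)[OF _ _ shift part] fr u frequency_mono[OF fr]
      by (auto simp: s dterm_shift frequency_def mono_def)
    from 1 have c: "summable (dterm lam a s)" by (simp add: summable_iff_shift)
    have "dsum lam a s - (\<Sum>n<m. dterm lam a s n) = (\<Sum>n. dterm lam a s (n + m))"
      unfolding dsum_def using suminf_split_initial_segment[OF c, of m] by simp
    with 2 c show "dconv lam a s \<and>
        cmod (dsum lam a s - (\<Sum>n<m. dterm lam a s n)) \<le> \<epsilon> * cmod (s - s0) / (Re s - Re s0)"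
      by (simp add: dconv_def u_def)
  qed
qed

lemma dconv_right:
  assumes "frequency lam" "dconv lam a s0" "Re s0 < Re s"
  shows "dconv lam a s"
  using dconv_tail_bound[OF assms(1,2) zero_less_one] assms(3) by blast

lemma sigma_c_le: "frequency lam \<Longrightarrow> dconv lam a s0 \<Longrightarrow> sigma_c lam a \<le> ereal (Re s0)"
  unfolding sigma_c_def by (rule Inf_lower) (auto intro: dconv_right)

lemma sigma_c_less_dconv: "sigma_c lam a < ereal (Re s) \<Longrightarrow> dconv lam a s"
  unfolding sigma_c_def Inf_less_iff by auto

lemma dsum_holomorphic:
  assumes fr: "frequency lam" and conv: "\<And>s. \<sigma> < Re s \<Longrightarrow> dconv lam a s"
  shows "dsum lam a holomorphic_on half_plane \<sigma>"
proof (rule holomorphic_uniform_sequence[OF open_half_plane])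
  show "(\<lambda>s. \<Sum>n<m. dterm lam a s n) holomorphic_on half_plane \<sigma>" for m
    unfolding dterm_eq by (intro holomorphic_intros)
  fix s assume "s \<in> half_plane \<sigma>"
  \<comment> \<open>With a third of the distance to the boundary, \<open>s0\<close> lies 2d to the
    left of s and still inside. On the disc of radius d the ratio |z - s0| / (Re z - Re s0) is then
    at most 3, which the choice e/6 below absorbs.\<close>
  define d where "d = (Re s - \<sigma>) / 3"
  define s0 where "s0 = s - of_real (2 * d)"
  have d: "0 < d" "\<sigma> < Re s0" "Re s0 = Re s - 2 * d"
    using \<open>s \<in> half_plane \<sigma>\<close> by (auto simp: d_def s0_def field_simps)
  have near: "d \<le> Re z - Re s0 \<and> cmod (z - s0) \<le> 3 * d" if "z \<in> cball s d" for z
  proof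
    have dz: "cmod (s - z) \<le> d" using that by (simp add: dist_norm)
    then show "d \<le> Re z - Re s0" using abs_Re_le_cmod[of "s - z"] d by simp
    have "z - s0 = - (s - z) + of_real (2 * d)" by (simp add: s0_def)
    then have "cmod (z - s0) \<le> cmod (s - z) + cmod (of_real (2 * d))"
      using norm_triangle_ineq[of "- (s - z)" "of_real (2 * d)"] by (metis norm_minus_cancel)
    with dz d show "cmod (z - s0) \<le> 3 * d" by simp
  qed
  have "uniform_limit (cball s d) (\<lambda>m s. \<Sum>n<m. dterm lam a s n) (dsum lam a) sequentially"
    unfolding uniform_limit_iff
  proof (intro allI impI)
    fix e :: real assume "0 < e"
    then have "0 < e / 6" by simp
    from dconv_tail_bound[OF fr conv[OF d(2)] this] obtain m0 where
      m0: "\<And>m z. m \<ge> m0 \<Longrightarrow> Re s0 < Re z \<Longrightarrow>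
        cmod (dsum lam a z - (\<Sum>n<m. dterm lam a z n)) \<le> e / 6 * cmod (z - s0) / (Re z - Re s0)"
      by blast
    have "dist (\<Sum>n<m. dterm lam a z n) (dsum lam a z) < e" if "m \<ge> m0" "z \<in> cball s d" for m z
    proof -
      have n: "d \<le> Re z - Re s0" "cmod (z - s0) \<le> 3 * d" using near[OF that(2)] by auto
      have "cmod (dsum lam a z - (\<Sum>n<m. dterm lam a z n)) \<le> e / 6 * cmod (z - s0) / (Re z - Re s0)"
        using m0[OF that(1)] n d by simp
      also have "\<dots> \<le> e / 6 * (3 * d) / d"
        using n d \<open>0 < e\<close> by (intro frac_le mult_left_mono) auto
      also have "\<dots> < e" using d \<open>0 < e\<close> by simp
      finally show ?thesis by (simp add: dist_norm norm_minus_commute)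
    qed
    then show "\<forall>\<^sub>F m in sequentially. \<forall>z\<in>cball s d. dist (\<Sum>n<m. dterm lam a z n) (dsum lam a z) < e"
      unfolding eventually_sequentially by blast
  qed
  moreover have "cball s d \<subseteq> half_plane \<sigma>" using near d by fastforce
  ultimately show "\<exists>d>0. cball s d \<subseteq> half_plane \<sigma> \<and>
      uniform_limit (cball s d) (\<lambda>m s. \<Sum>n<m. dterm lam a s n) (dsum lam a) sequentially"
    using d(1) by blast
qed

subsection \<open>Averages along vertical lines\<close>

text \<open>The first moment, not just integrability, is required because remainders of Dirichlet
  series are controlled only up to a factor linear in t.\<close>

locale line_kernel =
  fixes k :: "real \<Rightarrow> complex"
  assumes continuous: "continuous_on UNIV k"
    and integrable_moment: "integrable lborel (\<lambda>t. (1 + \<bar>t\<bar>) * cmod (k t))"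
begin

lemma measurable [measurable]: "k \<in> borel_measurable borel"
  using continuous by (rule borel_measurable_continuous_onI)

lemma integrable_norm: "integrable lborel (\<lambda>t. cmod (k t))"
  by (rule Bochner_Integration.integrable_bound[OF integrable_moment])
     (auto simp: algebra_simps intro!: AE_I2)

definition L1 :: real where "L1 = (LINT t|lborel. cmod (k t))"

definition transform :: "real \<Rightarrow> complex" where
  "transform x = (LINT t|lborel. exp (- (of_real x * (\<i> * of_real t))) * k t)"

lemma integrable_times:
  assumes "continuous_on UNIV g" "\<And>t. cmod (g t) \<le> M"
  shows "integrable lborel (\<lambda>t. g t * k t)" "cmod (LINT t|lborel. g t * k t) \<le> M * L1"
proof -
  have [measurable]: "g \<in> borel_measurable borel"
    using assms(1) by (rule borel_measurable_continuous_onI)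
  have M: "0 \<le> M" using assms(2) norm_ge_zero order_trans by blast
  show i: "integrable lborel (\<lambda>t. g t * k t)"
    by (rule Bochner_Integration.integrable_bound[OF integrable_mult_right[OF integrable_norm, of M]])
       (use assms(2) M in \<open>auto simp: norm_mult abs_mult intro!: AE_I2 mult_right_mono\<close>)
  have "cmod (LINT t|lborel. g t * k t) \<le> (LINT t|lborel. cmod (g t * k t))"
    by (rule integral_norm_bound)
  also have "\<dots> \<le> (LINT t|lborel. M * cmod (k t))"
  proof (rule integral_mono)
    show "integrable lborel (\<lambda>t. cmod (g t * k t))" using i by (rule Bochner_Integration.integrable_norm)
  qed (use integrable_norm assms(2) in \<open>auto simp: norm_mult intro!: mult_right_mono\<close>)
  finally show "cmod (LINT t|lborel. g t * k t) \<le> M * L1" by (simp add: L1_def)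
qed

definition average :: "(complex \<Rightarrow> complex) \<Rightarrow> complex \<Rightarrow> complex" where
  "average f s = (LINT t|lborel. f (s + \<i> * of_real t) * k t)"

definition tail :: "nat \<Rightarrow> real" where
  "tail n = (LINT t|lborel. indicator (- {- real n..real n}) t * cmod (k t))"

lemma tail_tendsto: "tail \<longlonglongrightarrow> 0"
proof -
  have "(\<lambda>n. LINT t|lborel. indicator (- {- real n..real n}) t * cmod (k t)) \<longlonglongrightarrow> (LINT t|(lborel :: real measure). 0)"
  proof (rule integral_dominated_convergence[where w = "\<lambda>t. cmod (k t)"])
    show "AE t in lborel. (\<lambda>n. indicator (- {- real n..real n}) t * cmod (k t)) \<longlonglongrightarrow> 0"
    proof (rule AE_I2, rule tendsto_eventually)
      fix t :: real
      obtain N where "\<bar>t\<bar> \<le> real N" using real_arch_simple by blast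
      then have "indicator (- {- real n..real n}) t * cmod (k t) = 0" if "n \<ge> N" for n
        using that by (auto simp: indicator_def)
      then show "\<forall>\<^sub>F n in sequentially. indicator (- {- real n..real n}) t * cmod (k t) = 0"
        unfolding eventually_sequentially by blast
    qed
  qed (auto intro!: AE_I2 integrable_norm simp: indicator_def)
  then show ?thesis by (simp add: tail_def [abs_def])
qed

context
  fixes f :: "complex \<Rightarrow> complex" and M :: real
  assumes hol: "f holomorphic_on half_plane 0" and bd: "\<And>s. 0 < Re s \<Longrightarrow> cmod (f s) \<le> M"
begin

lemma continuous_on_line:
  assumes "0 < Re s" shows "continuous_on UNIV (\<lambda>t. f (s + \<i> * of_real t))"
  by (rule continuous_on_compose2[OF holomorphic_on_imp_continuous_on[OF hol]])
     (use assms in \<open>auto intro!: continuous_intros\<close>)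

lemma average_bound:
  assumes "0 < Re s" shows "cmod (average f s) \<le> M * L1"
  unfolding average_def by (rule integrable_times(2)[OF continuous_on_line]) (use assms bd in auto)

lemma average_truncated:
  assumes "0 < Re s"
  shows "cmod (average f s - integral (cbox (- real n) (real n)) (\<lambda>t. f (s + \<i> * of_real t) * k t)) \<le> M * tail n"
proof -
  let ?g = "\<lambda>t. f (s + \<i> * of_real t) * k t"
  have g: "integrable lborel ?g"
    by (rule integrable_times(1)[OF continuous_on_line, where M = M]) (use assms bd in auto)
  have M: "0 \<le> M" using bd[OF assms] norm_ge_zero order_trans by blast
  have s1: "set_integrable lborel {- real n..real n} ?g"
    by (rule set_integrable_subset[of _ UNIV]) (use g in \<open>auto simp: set_integrable_def\<close>)
  have s2: "set_integrable lborel (- {- real n..real n}) ?g"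
    by (rule set_integrable_subset[of _ UNIV]) (use g in \<open>auto simp: set_integrable_def\<close>)
  have "average f s = (LINT t:{- real n..real n} \<union> - {- real n..real n}|lborel. ?g t)"
    by (simp add: average_def set_lebesgue_integral_def)
  also have "\<dots> = (LINT t:{- real n..real n}|lborel. ?g t) + (LINT t:- {- real n..real n}|lborel. ?g t)"
    by (rule set_integral_Un[OF _ s1 s2]) auto
  also have "(LINT t:{- real n..real n}|lborel. ?g t) = integral (cbox (- real n) (real n)) ?g"
    using set_borel_integral_eq_integral(2)[OF s1] by simp
  finally have "average f s - integral (cbox (- real n) (real n)) ?g = (LINT t:- {- real n..real n}|lborel. ?g t)"
    by simp
  also have "cmod \<dots> \<le> (LINT t|lborel. cmod (indicator (- {- real n..real n}) t *\<^sub>R ?g t))"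
    unfolding set_lebesgue_integral_def by (rule integral_norm_bound)
  also have "\<dots> \<le> (LINT t|lborel. M * (indicator (- {- real n..real n}) t * cmod (k t)))"
  proof (rule integral_mono)
    show "integrable lborel (\<lambda>t. cmod (indicator (- {- real n..real n}) t *\<^sub>R ?g t))"
      using s2 unfolding set_integrable_def by (rule Bochner_Integration.integrable_norm)
    show "integrable lborel (\<lambda>t. M * (indicator (- {- real n..real n}) t * cmod (k t)))"
      using integrable_mult_indicator[OF _ integrable_norm, of "- {- real n..real n}"] by simp
    show "cmod (indicator (- {- real n..real n}) t *\<^sub>R ?g t)
        \<le> M * (indicator (- {- real n..real n}) t * cmod (k t))" for t
      using bd[of "s + \<i> * of_real t"] assms
      by (auto simp: norm_mult indicator_def intro!: mult_right_mono)
  qed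
  finally show ?thesis by (simp add: tail_def)
qed

text \<open>Differentiation under the integral sign takes place on compact windows [-n, n]. The
  truncation error \<open>M * tail n\<close> does not depend on s, so the holomorphic truncations
  converge uniformly.\<close>

lemma average_holomorphic: "average f holomorphic_on half_plane 0"
proof (rule holomorphic_uniform_sequence[OF open_half_plane])
  fix n
  let ?I = "cbox (- real n) (real n)"
  have line: "continuous_on (half_plane 0 \<times> ?I) (\<lambda>(s, t). h (s + \<i> * of_real t) * k t)"
    if "h holomorphic_on half_plane 0" for h
  proof -
    have "continuous_on (half_plane 0 \<times> ?I) (\<lambda>x. h (fst x + \<i> * of_real (snd x)) * k (snd x))"
      by (intro continuous_on_mult
           continuous_on_compose2[OF holomorphic_on_imp_continuous_on[OF that]]
           continuous_on_compose2[OF continuous] continuous_intros) auto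
    then show ?thesis by (simp add: case_prod_unfold)
  qed
  show "(\<lambda>s. integral ?I (\<lambda>t. f (s + \<i> * of_real t) * k t)) holomorphic_on half_plane 0"
  proof (rule leibniz_rule_holomorphic[where fx = "\<lambda>s t. deriv f (s + \<i> * of_real t) * k t"])
    fix s t assume "s \<in> half_plane 0"
    then have "(f has_field_derivative deriv f (s + \<i> * of_real t)) (at (s + \<i> * of_real t))"
      using holomorphic_derivI[OF hol open_half_plane] by simp
    then have "((\<lambda>s. f (s + \<i> * of_real t)) has_field_derivative deriv f (s + \<i> * of_real t)) (at s)"
      by (simp add: DERIV_shift)
    then show "((\<lambda>s. f (s + \<i> * of_real t) * k t) has_field_derivative deriv f (s + \<i> * of_real t) * k t)
        (at s within half_plane 0)"
      by (rule has_field_derivative_at_within[OF DERIV_cmult_right])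
  next
    fix s assume "s \<in> half_plane 0"
    then have "0 < Re s" by simp
    then have "continuous_on UNIV (\<lambda>t. f (s + \<i> * of_real t) * k t)"
      by (rule continuous_on_mult[OF continuous_on_line continuous])
    then show "(\<lambda>t. f (s + \<i> * of_real t) * k t) integrable_on ?I"
      by (rule integrable_continuous[OF continuous_on_subset]) simp
  next
    show "continuous_on (half_plane 0 \<times> ?I) (\<lambda>(s, t). deriv f (s + \<i> * of_real t) * k t)"
      by (rule line) (rule holomorphic_deriv[OF hol open_half_plane])
  qed (rule convex_half_plane)
next
  fix s assume "s \<in> half_plane 0"
  then obtain d where d: "0 < d" "cball s d \<subseteq> half_plane 0"
    using open_half_plane open_contains_cball by blast
  have "uniform_limit (cball s d)
     (\<lambda>n s. integral (cbox (- real n) (real n)) (\<lambda>t. f (s + \<i> * of_real t) * k t)) (average f) sequentially"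
    unfolding uniform_limit_iff
  proof (intro allI impI)
    fix e :: real assume "0 < e"
    have "(\<lambda>n. M * tail n) \<longlonglongrightarrow> 0" using tendsto_mult_left[OF tail_tendsto, of M] by simp
    then have "\<forall>\<^sub>F n in sequentially. M * tail n < e" using \<open>0 < e\<close> order_tendstoD(2) by blast
    then show "\<forall>\<^sub>F n in sequentially. \<forall>z\<in>cball s d.
        dist (integral (cbox (- real n) (real n)) (\<lambda>t. f (z + \<i> * of_real t) * k t)) (average f z) < e"
    proof eventually_elim
      case (elim n)
      show ?case
      proof
        fix z assume "z \<in> cball s d"
        then have "0 < Re z" using d(2) by auto
        from average_truncated[OF this, of n] elim
        show "dist (integral (cbox (- real n) (real n)) (\<lambda>t. f (z + \<i> * of_real t) * k t)) (average f z) < e"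
          by (simp add: dist_norm norm_minus_commute)
      qed
    qed
  qed
  with d show "\<exists>d>0. cball s d \<subseteq> half_plane 0 \<and> uniform_limit (cball s d)
     (\<lambda>n s. integral (cbox (- real n) (real n)) (\<lambda>t. f (s + \<i> * of_real t) * k t)) (average f) sequentially"
    by blast
qed

end

lemma average_dirichlet_polynomial:
  "integrable lborel (\<lambda>t. (\<Sum>n<m. dterm lam a (s + \<i> * of_real t) n) * k t)"
  "(LINT t|lborel. (\<Sum>n<m. dterm lam a (s + \<i> * of_real t) n) * k t) = (\<Sum>n<m. dterm lam a s n * transform (lam n))"
proof -
  have i: "integrable lborel (\<lambda>t. exp (- (of_real x * (\<i> * of_real t))) * k t)" for x :: real
    by (rule integrable_times(1)[where M = 1]) (auto intro!: continuous_intros)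
  have eq: "(\<lambda>t. (\<Sum>n<m. dterm lam a (s + \<i> * of_real t) n) * k t) =
    (\<lambda>t. \<Sum>n<m. dterm lam a s n * (exp (- (of_real (lam n) * (\<i> * of_real t))) * k t))"
    using dterm_shift[of lam a "\<i> * of_real _" s]
    by (simp add: sum_distrib_right add.commute mult.assoc)
  show "integrable lborel (\<lambda>t. (\<Sum>n<m. dterm lam a (s + \<i> * of_real t) n) * k t)"
    unfolding eq by (intro Bochner_Integration.integrable_sum integrable_mult_right i)
  show "(LINT t|lborel. (\<Sum>n<m. dterm lam a (s + \<i> * of_real t) n) * k t)
      = (\<Sum>n<m. dterm lam a s n * transform (lam n))"
    unfolding eq by (subst Bochner_Integration.integral_sum) (auto simp: i transform_def)
qed

lemma linear_growth_bound:
  assumes "integrable lborel (\<lambda>t. g t * k t)" "\<And>t. cmod (g t) \<le> A * (1 + \<bar>t\<bar>)"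
  shows "cmod (LINT t|lborel. g t * k t) \<le> A * (LINT t|lborel. (1 + \<bar>t\<bar>) * cmod (k t))"
proof -
  have "cmod (LINT t|lborel. g t * k t) \<le> (LINT t|lborel. cmod (g t * k t))"
    by (rule integral_norm_bound)
  also have "\<dots> \<le> (LINT t|lborel. A * ((1 + \<bar>t\<bar>) * cmod (k t)))"
  proof (rule integral_mono)
    show "integrable lborel (\<lambda>t. cmod (g t * k t))"
      using assms(1) by (rule Bochner_Integration.integrable_norm)
    show "integrable lborel (\<lambda>t. A * ((1 + \<bar>t\<bar>) * cmod (k t)))"
      by (intro integrable_mult_right integrable_moment)
    show "cmod (g t * k t) \<le> A * ((1 + \<bar>t\<bar>) * cmod (k t))" for t
      using mult_right_mono[OF assms(2), of "cmod (k t)" t] by (simp add: norm_mult mult.assoc)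
  qed
  finally show ?thesis by simp
qed

text \<open>Far to the right f is the sum of its series and may be replaced by partial sums, whose
  averages are Dirichlet polynomials. Both sides of the resulting identity are holomorphic on Re s >
  0, where the average is bounded although the series may diverge.\<close>

lemma smoothed_bound:
  assumes fr: "frequency lam" and conv: "dconv lam a s0"
    and hol: "f holomorphic_on half_plane 0" and bd: "\<And>s. 0 < Re s \<Longrightarrow> cmod (f s) \<le> M"
    and eq: "\<And>s. R < Re s \<Longrightarrow> f s = dsum lam a s"
    and zero: "\<And>n. N \<le> n \<Longrightarrow> transform (lam n) = 0"
    and "0 < Re s"
  shows "cmod (\<Sum>n<N. dterm lam a s n * transform (lam n)) \<le> M * L1"
proof -
  define R' where "R' = max (max R (Re s0)) 0"
  have "average f z = (\<Sum>n<N. dterm lam a z n * transform (lam n))" if "R' < Re z" for z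
  proof -
    define J where "J = (LINT t|lborel. (1 + \<bar>t\<bar>) * cmod (k t))"
    define K where "K = (cmod (z - s0) + 1) * J / (Re z - Re s0)"
    have z: "R < Re z" "Re s0 < Re z" "0 < Re z" using that by (auto simp: R'_def)
    have close: "cmod (average f z - (\<Sum>n<N. dterm lam a z n * transform (lam n))) \<le> \<epsilon> * K" if \<epsilon>: "0 < \<epsilon>" for \<epsilon>
    proof -
      \<comment> \<open>Terms with index from N to m have weight zero, so m may depend on \<epsilon>
        while the polynomial does not.\<close>
      obtain m where m: "N \<le> m" and tb: "\<And>s. Re s0 < Re s \<Longrightarrow>
          cmod (dsum lam a s - (\<Sum>n<m. dterm lam a s n)) \<le> \<epsilon> * cmod (s - s0) / (Re s - Re s0)"
        using dconv_tail_bound[OF fr conv \<epsilon>] by (metis max.cobounded1 max.cobounded2)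
      let ?S = "\<lambda>t. \<Sum>n<m. dterm lam a (z + \<i> * of_real t) n"
      let ?f = "\<lambda>t. f (z + \<i> * of_real t)"
      have if1: "integrable lborel (\<lambda>t. ?f t * k t)"
        by (rule integrable_times(1)[OF continuous_on_line[OF hol bd], where M = M]) (use z bd in auto)
      note if2 = average_dirichlet_polynomial(1)[where m = m and lam = lam and a = a and s = z]
      have "(\<Sum>n<N. dterm lam a z n * transform (lam n)) = (\<Sum>n<m. dterm lam a z n * transform (lam n))"
        by (rule sum.mono_neutral_left) (use m zero in auto)
      also have "\<dots> = (LINT t|lborel. ?S t * k t)"
        by (simp add: average_dirichlet_polynomial(2))
      finally have d: "average f z - (\<Sum>n<N. dterm lam a z n * transform (lam n))
          = (LINT t|lborel. (?f t - ?S t) * k t)"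
        using Bochner_Integration.integral_diff[OF if1 if2] by (simp add: average_def left_diff_distrib)
      have "cmod (LINT t|lborel. (?f t - ?S t) * k t) \<le> \<epsilon> * (cmod (z - s0) + 1) / (Re z - Re s0) * J"
        unfolding J_def
      proof (rule linear_growth_bound)
        show "integrable lborel (\<lambda>t. (?f t - ?S t) * k t)"
          using Bochner_Integration.integrable_diff[OF if1 if2] by (simp add: left_diff_distrib)
        fix t :: real
        define w where "w = z + \<i> * of_real t"
        have Rew: "Re w = Re z" by (simp add: w_def)
        have "cmod (w - s0) \<le> cmod (z - s0) + cmod (\<i> * of_real t)"
          using norm_triangle_ineq[of "z - s0" "\<i> * of_real t"] by (simp add: w_def diff_add_eq)
        also have "\<dots> = cmod (z - s0) + \<bar>t\<bar>" by (simp add: norm_mult)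
        also have "\<dots> \<le> (cmod (z - s0) + 1) * (1 + \<bar>t\<bar>)"
          using mult_nonneg_nonneg[of "cmod (z - s0)" "\<bar>t\<bar>"] by (simp add: ring_distribs)
        finally have w: "cmod (w - s0) \<le> (cmod (z - s0) + 1) * (1 + \<bar>t\<bar>)" .
        have "cmod (f w - (\<Sum>n<m. dterm lam a w n)) \<le> \<epsilon> * cmod (w - s0) / (Re w - Re s0)"
          using tb[of w] eq[of w] z Rew by simp
        also have "\<dots> \<le> \<epsilon> * ((cmod (z - s0) + 1) * (1 + \<bar>t\<bar>)) / (Re z - Re s0)"
          using w z \<epsilon> Rew by (simp add: divide_right_mono mult_left_mono)
        finally show "cmod (?f t - ?S t) \<le> \<epsilon> * (cmod (z - s0) + 1) / (Re z - Re s0) * (1 + \<bar>t\<bar>)"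
          by (simp add: w_def)
      qed
      then show ?thesis by (simp add: d K_def mult.assoc)
    qed
    have "0 \<le> J" unfolding J_def by simp
    then have K: "0 \<le> K" using z by (simp add: K_def)
    have "cmod (average f z - (\<Sum>n<N. dterm lam a z n * transform (lam n))) \<le> 0"
    proof (rule field_le_epsilon)
      fix e :: real assume "0 < e"
      then have "e / (K + 1) * K \<le> e" using K by (simp add: field_simps)
      with close[of "e / (K + 1)"] \<open>0 < e\<close> K
      show "cmod (average f z - (\<Sum>n<N. dterm lam a z n * transform (lam n))) \<le> 0 + e" by simp
    qed
    then show ?thesis by simp
  qed
  \<comment> \<open>The passage from the half-plane beyond \<open>R'\<close> to all of Re s >
    0.\<close>
  moreover have "(\<lambda>s. \<Sum>n<N. dterm lam a s n * transform (lam n)) holomorphic_on half_plane 0"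
    unfolding dterm_eq by (intro holomorphic_intros)
  ultimately have "average f s = (\<Sum>n<N. dterm lam a s n * transform (lam n))"
    using half_plane_identity[OF average_holomorphic[OF hol bd]] \<open>0 < Re s\<close> by blast
  with average_bound[OF hol bd \<open>0 < Re s\<close>] show ?thesis by simp
qed

end

subsection \<open>Vertical integrals\<close>

lemma vertical_integral_bound:
  assumes "G contour_integrable_on linepath (Complex r (- T)) (Complex r T)" "0 \<le> T" "0 \<le> m"
    and "\<And>z. Re z = r \<Longrightarrow> \<bar>Im z\<bar> \<le> T \<Longrightarrow> cmod (G z) \<le> m"
  shows "cmod (contour_integral (linepath (Complex r (- T)) (Complex r T)) G) \<le> m * (2 * T)"
proof -
  have "Complex r T - Complex r (- T) = Complex 0 (2 * T)" by (simp add: complex_eq_iff)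
  then have "cmod (Complex r T - Complex r (- T)) = 2 * T" using assms(2) by (simp add: cmod_eq_Im)
  moreover have "cmod (contour_integral (linepath (Complex r (- T)) (Complex r T)) G)
      \<le> m * cmod (Complex r T - Complex r (- T))"
    by (rule contour_integral_bound_linepath[OF assms(1,3)])
       (use assms in \<open>auto simp: closed_segment_same_Re closed_segment_eq_real_ivl\<close>)
  ultimately show ?thesis by simp
qed

text \<open>In the integral around the rectangle the vertical edges enter with opposite
  orientations. What separates their difference from \<open>I\<close> are the two horizontal edges,
  each of length r - l.\<close>

lemma vertical_integrals_rectangle:
  assumes "l < r" "0 < T" "0 \<le> m"
    and I: "(G has_contour_integral I) (rectpath (Complex l (- T)) (Complex r T))"
    and cont: "continuous_on (path_image (rectpath (Complex l (- T)) (Complex r T))) G"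
    and bd: "\<And>z. \<bar>Im z\<bar> = T \<Longrightarrow> l \<le> Re z \<Longrightarrow> Re z \<le> r \<Longrightarrow> cmod (G z) \<le> m"
  shows "cmod (contour_integral (linepath (Complex r (- T)) (Complex r T)) G
    - contour_integral (linepath (Complex l (- T)) (Complex l T)) G - I) \<le> 2 * m * (r - l)"
proof -
  let ?a1 = "Complex l (- T)" and ?a2 = "Complex r (- T)" and ?a3 = "Complex r T" and ?a4 = "Complex l T"
  have rect: "rectpath ?a1 ?a3 = linepath ?a1 ?a2 +++ linepath ?a2 ?a3 +++ linepath ?a3 ?a4 +++ linepath ?a4 ?a1"
    by (simp add: rectpath_def Let_def)
  have int: "G contour_integrable_on linepath ?a1 ?a2" "G contour_integrable_on linepath ?a2 ?a3"
    "G contour_integrable_on linepath ?a3 ?a4" "G contour_integrable_on linepath ?a4 ?a1"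
    by (rule contour_integrable_continuous_linepath[OF continuous_on_subset[OF cont]];
        simp add: rect path_image_join; blast)+
  define J where "J = (\<lambda>a b. contour_integral (linepath a b) G)"
  have "I = contour_integral (rectpath ?a1 ?a3) G" using I by (rule contour_integral_unique[symmetric])
  also have "\<dots> = J ?a1 ?a2 + (J ?a2 ?a3 + (J ?a3 ?a4 + J ?a4 ?a1))"
    unfolding J_def by (simp add: int rect)
  also have "J ?a4 ?a1 = - J ?a1 ?a4"
    unfolding J_def using contour_integral_reversepath[of "linepath ?a1 ?a4" G] by simp
  finally have "J ?a2 ?a3 - J ?a1 ?a4 - I = - J ?a1 ?a2 - J ?a3 ?a4" by (simp add: algebra_simps)
  then have "cmod (J ?a2 ?a3 - J ?a1 ?a4 - I) \<le> cmod (J ?a1 ?a2) + cmod (J ?a3 ?a4)"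
    using norm_triangle_ineq4[of "- J ?a1 ?a2" "J ?a3 ?a4"] by simp
  also have "cmod (J ?a1 ?a2) \<le> m * cmod (?a2 - ?a1)"
    unfolding J_def by (rule contour_integral_bound_linepath[OF int(1) assms(3)])
      (use assms(1,2) bd in \<open>auto simp: closed_segment_same_Im closed_segment_eq_real_ivl\<close>)
  also have "cmod (J ?a3 ?a4) \<le> m * cmod (?a4 - ?a3)"
    unfolding J_def by (rule contour_integral_bound_linepath[OF int(3) assms(3)])
      (use assms(1,2) bd in \<open>auto simp: closed_segment_same_Im closed_segment_eq_real_ivl\<close>)
  also have "m * cmod (?a2 - ?a1) + m * cmod (?a4 - ?a3) = 2 * m * (r - l)"
    using assms(1) by (simp add: cmod_eq_Re)
  finally show ?thesis by (simp add: J_def)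
qed

text \<open>Effective near 0; for large w the constant 2 of the next lemma takes over. The two
  bounds make the kernel behave like 1/|z| at first and like 1/|z|^3 further out.\<close>

lemma norm_one_minus_exp_le:
  assumes "0 < Re w" shows "cmod (1 - exp (- w)) \<le> cmod w"
proof -
  have "cmod (exp (- w) - 1) \<le> cmod w / Re w * (1 - exp (- Re w))"
    using exp_increment_bound[of 0 w 0 1] assms by simp
  also have "\<dots> \<le> cmod w / Re w * Re w"
    using exp_ge_add_one_self[of "- Re w"] assms by (intro mult_left_mono) auto
  finally show ?thesis using assms by (simp add: norm_minus_commute)
qed

lemma norm_one_minus_exp_le_2:
  assumes "0 \<le> Re w" shows "cmod (1 - exp (- w)) \<le> 2"
proof -
  have "cmod (1 - exp (- w)) \<le> 1 + exp (- Re w)"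
    using norm_triangle_ineq4[of 1 "exp (- w)"] by simp
  also have "\<dots> \<le> 2" using assms by simp
  finally show ?thesis .
qed

subsection \<open>A smooth Perron kernel\<close>

text \<open>The Laplace transform of a smoothed unit step: 1/z for the step, times (1 -
  e^{-Bz})/(Bz) for each of two averages over delays in [0, B]. The smoothed step reaches 1 at 2B,
  and the two averages provide the decay |z|^{-3}.\<close>

definition perron_factor :: "real \<Rightarrow> complex \<Rightarrow> complex" where
  "perron_factor B z = (1 - exp (- (of_real B * z)))\<^sup>2 / (of_real B ^ 2 * z ^ 3)"

lemma perron_factor_holomorphic:
  assumes "0 < B" "0 \<notin> S" shows "perron_factor B holomorphic_on S"
  unfolding perron_factor_def using assms by (auto intro!: holomorphic_intros)

lemma perron_factor_bound:
  assumes "0 < B" "0 \<le> Re z" "0 < R" "R \<le> cmod z"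
  shows "cmod (perron_factor B z) \<le> 4 / (B\<^sup>2 * R ^ 3)"
proof -
  have "cmod (1 - exp (- (of_real B * z))) \<le> 2"
    using assms by (intro norm_one_minus_exp_le_2) auto
  then have "(cmod (1 - exp (- (of_real B * z))))\<^sup>2 \<le> 2\<^sup>2" by (rule power_mono) simp
  moreover have "B\<^sup>2 * R ^ 3 \<le> B\<^sup>2 * cmod z ^ 3" using assms by (intro mult_left_mono power_mono) auto
  ultimately show ?thesis
    using assms unfolding perron_factor_def norm_divide norm_mult norm_power
    by (intro frac_le) auto
qed

text \<open>Right of the support the contour closes to the right, where there is no pole.\<close>

lemma perron_integral_tail:
  assumes "0 < B" "0 < c" "c < T" "0 \<le> y"
  shows "cmod (contour_integral (linepath (Complex c (- T)) (Complex c T))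
    (\<lambda>z. exp (- (of_real y * z)) * perron_factor B z)) \<le> 16 / (B\<^sup>2 * T\<^sup>2)"
proof -
  let ?G = "\<lambda>z. exp (- (of_real y * z)) * perron_factor B z"
  \<comment> \<open>The other three sides of the rectangle keep distance at least T from 0, where
    the integrand is at most \<open>m\<close>. Their total length is at most 4T.\<close>
  define m where "m = 4 / (B\<^sup>2 * T ^ 3)"
  have m: "0 \<le> m" using assms by (simp add: m_def)
  have G: "cmod (?G z) \<le> m" if "0 \<le> Re z" "T \<le> cmod z" for z
  proof -
    have "cmod (?G z) \<le> 1 * m"
      unfolding norm_mult m_def using assms that by (intro mult_mono perron_factor_bound) auto
    then show ?thesis by simp
  qed
  have big: "T \<le> cmod z" if "\<bar>Im z\<bar> = T \<or> Re z = T" for z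
    using that abs_Im_le_cmod[of z] abs_Re_le_cmod[of z] assms by auto
  have hol: "?G holomorphic_on half_plane 0"
    by (intro holomorphic_intros perron_factor_holomorphic) (use assms in auto)
  have sub: "path_image (rectpath (Complex c (- T)) (Complex T T)) \<subseteq> half_plane 0"
    using path_image_rectpath_subset_cbox[of "Complex c (- T)" "Complex T T"] assms
    by (auto simp: in_cbox_complex_iff)
  have I: "(?G has_contour_integral 0) (rectpath (Complex c (- T)) (Complex T T))"
    by (rule Cauchy_theorem_convex_simple[OF hol convex_half_plane _ sub]) auto
  have seg: "?G contour_integrable_on linepath (Complex T (- T)) (Complex T T)"
    by (rule contour_integrable_continuous_linepath[OF
          continuous_on_subset[OF holomorphic_on_imp_continuous_on[OF hol]]])
       (use assms in \<open>auto simp: closed_segment_same_Re\<close>)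
  let ?L = "contour_integral (linepath (Complex c (- T)) (Complex c T)) ?G"
  let ?R = "contour_integral (linepath (Complex T (- T)) (Complex T T)) ?G"
  have "cmod (?R - ?L - 0) \<le> 2 * m * (T - c)"
    by (rule vertical_integrals_rectangle[OF _ _ m I
          continuous_on_subset[OF holomorphic_on_imp_continuous_on[OF hol] sub]])
       (use assms G big in auto)
  moreover have "cmod ?R \<le> m * (2 * T)"
    by (rule vertical_integral_bound[OF seg _ m]) (use assms G big in auto)
  moreover have "cmod ?L \<le> cmod ?R + cmod (?R - ?L)"
    using norm_triangle_ineq4[of ?R "?R - ?L"] by simp
  moreover have "2 * m * (T - c) \<le> 2 * m * T" using m assms by (simp add: mult_left_mono)
  ultimately have "cmod ?L \<le> 4 * m * T" by simp
  also have "\<dots> = 16 / (B\<^sup>2 * T\<^sup>2)" using assms by (simp add: m_def field_simps power2_eq_square power3_eq_cube)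
  finally show ?thesis .
qed

text \<open>Where the weight is \<open>1\<close>, the contour closes to the left and picks up the simple pole at \<open>0\<close>.\<close>

lemma perron_integral_main:
  assumes "0 < B" "0 < c" "c < T" "2 * B \<le> y"
  shows "cmod (contour_integral (linepath (Complex c (- T)) (Complex c T))
    (\<lambda>z. exp (of_real y * z) * perron_factor B z) - 2 * pi * \<i>)
      \<le> 6 * exp ((y - 2 * B) * c) * (exp (B * c) + 1)\<^sup>2 / (B\<^sup>2 * T\<^sup>2)"
proof -
  let ?G = "\<lambda>z. exp (of_real y * z) * perron_factor B z"
  define A where "A = exp ((y - 2 * B) * c) * (exp (B * c) + 1)\<^sup>2"
  define m where "m = A / (B\<^sup>2 * T ^ 3)"
  have A: "0 \<le> A" by (simp add: A_def)
  then have m: "0 \<le> m" using assms by (simp add: m_def)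
  have G: "cmod (?G z) \<le> m" if "Re z \<le> c" "T \<le> cmod z" for z
  proof -
    \<comment> \<open>Moving e^{2Bz} into the square turns 1 - e^{-Bz}, which explodes to the left,
      into the bounded e^{Bz} - 1. The remaining exponent y - 2B has to be nonnegative: hence weight
      1 only up to x - 2B.\<close>
    have "exp (of_real y * z) = exp (of_real (y - 2 * B) * z) * (exp (of_real B * z))\<^sup>2"
      by (simp add: power2_eq_square algebra_simps flip: exp_add)
    then have "?G z = exp (of_real (y - 2 * B) * z) * (exp (of_real B * z) * (1 - exp (- (of_real B * z))))\<^sup>2
        / (of_real B ^ 2 * z ^ 3)"
      by (simp add: perron_factor_def power_mult_distrib)
    also have "exp (of_real B * z) * (1 - exp (- (of_real B * z))) = exp (of_real B * z) - 1"
      by (simp add: right_diff_distrib flip: exp_add)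
    finally have eq: "cmod (?G z) = exp ((y - 2 * B) * Re z) * (cmod (exp (of_real B * z) - 1))\<^sup>2
        / (B\<^sup>2 * cmod z ^ 3)"
      using assms by (simp add: norm_mult norm_divide norm_power)
    have "cmod (exp (of_real B * z) - 1) \<le> exp (B * Re z) + 1"
      using norm_triangle_ineq4[of "exp (of_real B * z)" 1] by simp
    also have "\<dots> \<le> exp (B * c) + 1" using assms that by simp
    finally have "(cmod (exp (of_real B * z) - 1))\<^sup>2 \<le> (exp (B * c) + 1)\<^sup>2" by (rule power_mono) simp
    then have "exp ((y - 2 * B) * Re z) * (cmod (exp (of_real B * z) - 1))\<^sup>2 \<le> A"
      unfolding A_def using assms that by (intro mult_mono) (auto intro: mult_left_mono)
    moreover have "B\<^sup>2 * T ^ 3 \<le> B\<^sup>2 * cmod z ^ 3" using assms that by (intro mult_left_mono power_mono) auto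
    ultimately show ?thesis unfolding eq m_def using assms A by (intro frac_le) auto
  qed
  have big: "T \<le> cmod z" if "\<bar>Im z\<bar> = T \<or> Re z = - T" for z
    using that abs_Im_le_cmod[of z] abs_Re_le_cmod[of z] assms by auto
  let ?r = "rectpath (Complex (- T) (- T)) (Complex c T)"
  have zero: "0 \<in> box (Complex (- T) (- T)) (Complex c T)"
    using assms by (simp add: in_box_complex_iff)
  have sub: "path_image ?r \<subseteq> UNIV - {0}"
    using zero path_image_rectpath_cbox_minus_box[of "Complex (- T) (- T)" "Complex c T"] assms by auto
  have hol: "?G holomorphic_on UNIV - {0}"
    by (intro holomorphic_intros perron_factor_holomorphic) (use assms in auto)
  define e where "e = (\<lambda>z::complex. 1 - exp (- (of_real B * z)))"
  \<comment> \<open>The difference quotient of \<open>e\<close> at 0 with its removable singularity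
    filled in. It cancels two of the three powers of z and leaves \<open>h\<close> divided by z with
    h(0) = 1.\<close>
  define q where "q = (\<lambda>z. if z = 0 then deriv e 0 else (e z - e 0) / (z - 0))"
  have "deriv e 0 = of_real B"
    unfolding e_def by (rule DERIV_imp_deriv) (auto intro!: derivative_eq_intros)
  then have q0: "q 0 = of_real B" by (simp add: q_def)
  have qhol: "q holomorphic_on UNIV"
    unfolding q_def by (rule pole_lemma) (auto simp: e_def intro!: holomorphic_intros)
  define h where "h = (\<lambda>z. exp (of_real y * z) * (q z / of_real B)\<^sup>2)"
  have hhol: "h holomorphic_on UNIV"
    unfolding h_def using assms by (intro holomorphic_intros qhol) auto
  have "((\<lambda>w. h w / (w - 0)) has_contour_integral 2 * pi * \<i> * winding_number ?r 0 * h 0) ?r"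
    by (rule Cauchy_integral_formula_convex_simple[OF convex_UNIV hhol _ _ sub]) auto
  moreover have "winding_number ?r 0 = 1" by (rule winding_number_rectpath[OF zero])
  moreover have "h 0 = 1" using assms by (simp add: h_def q0)
  ultimately have "((\<lambda>w. h w / (w - 0)) has_contour_integral 2 * pi * \<i>) ?r" by simp
  then have I: "(?G has_contour_integral 2 * pi * \<i>) ?r"
  proof (rule has_contour_integral_eq)
    fix z assume "z \<in> path_image ?r"
    then have "z \<noteq> 0" using sub by auto
    then show "h z / (z - 0) = ?G z"
      using assms by (simp add: h_def q_def e_def perron_factor_def power_divide field_simps power2_eq_square power3_eq_cube)
  qed
  have seg: "?G contour_integrable_on linepath (Complex (- T) (- T)) (Complex (- T) T)"
    by (rule contour_integrable_continuous_linepath[OF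
          continuous_on_subset[OF holomorphic_on_imp_continuous_on[OF hol]]])
       (use assms in \<open>auto simp: closed_segment_same_Re\<close>)
  let ?R = "contour_integral (linepath (Complex c (- T)) (Complex c T)) ?G"
  let ?L = "contour_integral (linepath (Complex (- T) (- T)) (Complex (- T) T)) ?G"
  have "cmod (?R - ?L - 2 * pi * \<i>) \<le> 2 * m * (c - - T)"
    by (rule vertical_integrals_rectangle[OF _ _ m I
          continuous_on_subset[OF holomorphic_on_imp_continuous_on[OF hol] sub]])
       (use assms G big in auto)
  moreover have "cmod ?L \<le> m * (2 * T)"
    by (rule vertical_integral_bound[OF seg _ m]) (use assms G big in auto)
  moreover have "cmod (?R - 2 * pi * \<i>) \<le> cmod ?L + cmod (?R - ?L - 2 * pi * \<i>)"
    using norm_triangle_ineq[of ?L "?R - ?L - 2 * pi * \<i>"] by (simp add: algebra_simps)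
  moreover have "2 * m * (c - - T) \<le> 2 * m * (T + T)" using m assms by (intro mult_left_mono) auto
  \<comment> \<open>Two horizontal edges of length below 2T and a left edge of length 2T give the
    constant 6.\<close>
  moreover have "2 * m * (T + T) + m * (2 * T) = 6 * m * T" by (simp add: algebra_simps)
  ultimately have "cmod (?R - 2 * pi * \<i>) \<le> 6 * m * T" by linarith
  also have "\<dots> = 6 * A / (B\<^sup>2 * T\<^sup>2)" using assms by (simp add: m_def field_simps power2_eq_square power3_eq_cube)
  finally show ?thesis by (simp add: A_def mult.assoc)
qed

section \<open>The size of the kernel\<close>

lemma has_bochner_integral_abs_FTC:
  fixes g G :: "real \<Rightarrow> real"
  assumes meas: "g \<in> borel_measurable borel"
    and G: "\<And>t. 0 \<le> t \<Longrightarrow> (G has_real_derivative g t) (at t)"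
    and nonneg: "\<And>t. 0 \<le> t \<Longrightarrow> 0 \<le> g t"
    and lim: "(G \<longlongrightarrow> l) at_top"
  shows "has_bochner_integral lborel (\<lambda>t. g \<bar>t\<bar>) (2 * (l - G 0))"
proof -
  have [measurable]: "g \<in> borel_measurable borel" by fact
  have "0 \<le> l - G 0"
  proof -
    have "\<forall>\<^sub>F t in at_top. G 0 \<le> G t"
      using eventually_ge_at_top[of 0]
    proof eventually_elim
      case (elim t)
      show ?case
        by (rule DERIV_nonneg_imp_nondecreasing[OF elim]) (use G nonneg in blast)
    qed
    from tendsto_lowerbound[OF lim this] show ?thesis by simp
  qed
  moreover have "(\<integral>\<^sup>+t. ennreal (indicator {0..} t *\<^sub>R g \<bar>t\<bar>) \<partial>lborel) = ennreal (l - G 0)"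
    using nn_integral_FTC_atLeast[OF meas G nonneg lim]
    by (subst nn_integral_cong[where v = "\<lambda>t. ennreal (g t) * indicator {0..} t"])
       (auto simp: indicator_def)
  ultimately have "has_bochner_integral lborel (\<lambda>t. indicator {0..} t *\<^sub>R g \<bar>t\<bar>) (l - G 0)"
    by (intro has_bochner_integral_nn_integral) (auto simp: indicator_def nonneg)
  from has_bochner_integral_even_function[OF this] show ?thesis by simp
qed

text \<open>Partial fractions: 1/(v (1 + \<beta>v^2)) = 1/v - \<beta>v/(1 + \<beta>v^2).\<close>

lemma log_majorant_primitive:
  fixes v \<beta> :: real
  assumes v: "0 < v" and \<beta>: "0 < \<beta>"
  shows "((\<lambda>v. ln v - ln (1 + \<beta> * v\<^sup>2) / 2) has_real_derivative 1 / (v * (1 + \<beta> * v\<^sup>2))) (at v)"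
proof -
  have w: "0 < 1 + \<beta> * v\<^sup>2" using \<beta> by (intro add_pos_nonneg) auto
  have "((\<lambda>v. 1 + \<beta> * v\<^sup>2) has_real_derivative 2 * \<beta> * v) (at v)"
    by (auto intro!: derivative_eq_intros)
  from DERIV_diff[OF DERIV_ln_divide[OF v] DERIV_cdivide[OF DERIV_chain2[OF DERIV_ln_divide[OF w] this], of 2]]
  have "((\<lambda>v. ln v - ln (1 + \<beta> * v\<^sup>2) / 2) has_real_derivative
      1 / v - 1 / (1 + \<beta> * v\<^sup>2) * (2 * \<beta> * v) / 2) (at v)" .
  moreover have "1 / v - 1 / u * (2 * \<beta> * v) / 2 = (u - \<beta> * v\<^sup>2) / (v * u)" if "0 < u" for u
    using v that by (simp add: field_simps power2_eq_square)
  from this[OF w]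
  have "1 / v - 1 / (1 + \<beta> * v\<^sup>2) * (2 * \<beta> * v) / 2 = 1 / (v * (1 + \<beta> * v\<^sup>2))"
    by (simp only: add_diff_cancel_right')
  ultimately show ?thesis by (simp only:)
qed

text \<open>The two logarithms of the primitive cancel at infinity up to -ln \<beta> / 2. Only the
  value at c is left, so the integral grows logarithmically in 1/(\<beta>c^2).\<close>

lemma integral_log_majorant:
  fixes c \<beta> :: real
  assumes "0 < c" "0 < \<beta>"
  shows "has_bochner_integral lborel (\<lambda>t. 1 / ((c + \<bar>t\<bar>) * (1 + \<beta> * (c + \<bar>t\<bar>)\<^sup>2))) (ln (1 + 1 / (\<beta> * c\<^sup>2)))"
proof -
  define g where "g = (\<lambda>t. 1 / ((c + t) * (1 + \<beta> * (c + t)\<^sup>2)))"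
  define G where "G = (\<lambda>t. ln (c + t) - ln (1 + \<beta> * (c + t)\<^sup>2) / 2)"
  have "has_bochner_integral lborel (\<lambda>t. g \<bar>t\<bar>) (2 * (- ln \<beta> / 2 - G 0))"
  proof (rule has_bochner_integral_abs_FTC[where g = g and G = G])
    show "g \<in> borel_measurable borel" unfolding g_def by measurable
    fix t :: real assume "0 \<le> t"
    then have pos: "0 < c + t" "0 < 1 + \<beta> * (c + t)\<^sup>2"
      using assms by (auto intro: add_pos_nonneg)
    then show "0 \<le> g t" by (simp add: g_def)
    show "(G has_real_derivative g t) (at t)"
      using log_majorant_primitive[OF pos(1) assms(2)]
      by (simp add: G_def g_def DERIV_shift[of _ _ t c] add.commute[of c])
  next
    show "(G \<longlongrightarrow> - ln \<beta> / 2) at_top"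
      unfolding G_def using assms by real_asymp
  qed
  moreover have "2 * (- ln \<beta> / 2 - G 0) = ln (1 + 1 / (\<beta> * c\<^sup>2))"
  proof -
    have "1 + 1 / (\<beta> * c\<^sup>2) = (1 + \<beta> * c\<^sup>2) / (\<beta> * c\<^sup>2)" using assms by (simp add: field_simps)
    moreover have "0 < 1 + \<beta> * c\<^sup>2" using assms by (simp add: add_pos_pos)
    ultimately have "ln (1 + 1 / (\<beta> * c\<^sup>2)) = ln (1 + \<beta> * c\<^sup>2) - (ln \<beta> + 2 * ln c)"
      using assms by (simp add: ln_div ln_mult ln_realpow)
    then show ?thesis by (simp add: G_def)
  qed
  ultimately show ?thesis by (simp add: g_def)
qed

lemma integrable_inverse_square:
  assumes "0 < (c :: real)"
  shows "integrable lborel (\<lambda>t. 1 / (c + \<bar>t\<bar>)\<^sup>2)"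
proof -
  have "has_bochner_integral lborel (\<lambda>t. (\<lambda>t. 1 / (c + t)\<^sup>2) \<bar>t\<bar>) (2 * (0 - (- 1 / (c + 0))))"
  proof (rule has_bochner_integral_abs_FTC[where g = "\<lambda>t. 1 / (c + t)\<^sup>2" and G = "\<lambda>t. - 1 / (c + t)"])
    show "(\<lambda>t. 1 / (c + t)\<^sup>2) \<in> borel_measurable borel" by measurable
    show "((\<lambda>t. - 1 / (c + t)) has_real_derivative 1 / (c + t)\<^sup>2) (at t)" if "0 \<le> t" for t
      using that assms by (auto intro!: derivative_eq_intros simp: power2_eq_square)
    show "((\<lambda>t. - 1 / (c + t)) \<longlongrightarrow> 0) at_top" by real_asymp
  qed auto
  then show ?thesis by (simp add: has_bochner_integral_iff)
qed

definition perron_kernel :: "real \<Rightarrow> real \<Rightarrow> real \<Rightarrow> complex" where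
  "perron_kernel x B t = exp (of_real x * Complex (1 / x) t) * perron_factor B (Complex (1 / x) t) / (2 * pi)"

text \<open>On the line Re z = 1/x the factor e^{xz} has modulus e, and e < \<pi> absorbs it into
  the denominator. The sum 1/x + |t| replaces |z|, to which it is comparable, because it leads to an
  elementary primitive.\<close>

lemma perron_kernel_bound:
  assumes "0 < B" "0 < x"
  shows "cmod (perron_kernel x B t) \<le> 2 * (1 / ((1 / x + \<bar>t\<bar>) * (1 + B\<^sup>2 / 16 * (1 / x + \<bar>t\<bar>)\<^sup>2)))"
proof -
  define z where "z = Complex (1 / x) t"
  define v where "v = 1 / x + \<bar>t\<bar>"
  define r where "r = cmod z"
  define p where "p = cmod (1 - exp (- (of_real B * z)))"
  have Rez: "Re z = 1 / x" "Im z = t" by (simp_all add: z_def)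
  have v: "0 < v" using assms by (simp add: v_def add_pos_nonneg)
  have vr: "v \<le> 2 * r" unfolding v_def r_def
    using abs_Re_le_cmod[of z] abs_Im_le_cmod[of z] assms by (simp add: Rez)
  then have r: "0 < r" using v by linarith
  have p0: "0 \<le> p" by (simp add: p_def)
  have p1: "p \<le> B * r" unfolding p_def r_def
    using norm_one_minus_exp_le[of "of_real B * z"] assms by (simp add: Rez norm_mult)
  have p2: "p \<le> 2" unfolding p_def
    using norm_one_minus_exp_le_2[of "of_real B * z"] assms by (simp add: Rez)
  \<comment> \<open>The first summand is estimated by p \<le> Br, the second by p \<le> 2 and v
    \<le> 2r. The divisor 16 makes each contribute exactly B^2 r^2.\<close>
  have "p\<^sup>2 * (1 + B\<^sup>2 / 16 * v\<^sup>2) = p\<^sup>2 + p\<^sup>2 * (B\<^sup>2 / 16 * v\<^sup>2)" by (simp add: algebra_simps)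
  also have "\<dots> \<le> (B * r)\<^sup>2 + 2\<^sup>2 * (B\<^sup>2 / 16 * (2 * r)\<^sup>2)"
    using p0 p1 p2 vr v by (intro add_mono mult_mono power_mono) auto
  also have "\<dots> = 2 * (B\<^sup>2 * r\<^sup>2)" by (simp add: power_mult_distrib)
  finally have key: "p\<^sup>2 * (1 + B\<^sup>2 / 16 * v\<^sup>2) \<le> 2 * (B\<^sup>2 * r\<^sup>2)" .
  have pos: "0 < 1 + B\<^sup>2 / 16 * v\<^sup>2" by (intro add_pos_nonneg) auto
  have "p\<^sup>2 / (B\<^sup>2 * r ^ 3) \<le> 4 / (v * (1 + B\<^sup>2 / 16 * v\<^sup>2))"
  proof -
    have "p\<^sup>2 * (v * (1 + B\<^sup>2 / 16 * v\<^sup>2)) = v * (p\<^sup>2 * (1 + B\<^sup>2 / 16 * v\<^sup>2))" by simp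
    also have "\<dots> \<le> (2 * r) * (2 * (B\<^sup>2 * r\<^sup>2))"
      using mult_mono[OF vr key] r pos by simp
    also have "\<dots> = 4 * (B\<^sup>2 * r ^ 3)" by (simp add: power2_eq_square power3_eq_cube)
    finally have le: "p\<^sup>2 * (v * (1 + B\<^sup>2 / 16 * v\<^sup>2)) \<le> 4 * (B\<^sup>2 * r ^ 3)" .
    have "0 < B\<^sup>2 * r ^ 3" "0 < v * (1 + B\<^sup>2 / 16 * v\<^sup>2)" using r v pos assms by auto
    from mult_imp_le_div_pos[OF this(2) le] mult_imp_div_pos_le[OF this(1)]
    show ?thesis by (metis times_divide_eq_left)
  qed
  moreover have "cmod (perron_kernel x B t) = exp 1 / (2 * pi) * (p\<^sup>2 / (B\<^sup>2 * r ^ 3))"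
    using assms by (simp add: perron_kernel_def perron_factor_def norm_mult norm_divide norm_power p_def r_def z_def)
  moreover have "exp 1 / (2 * pi) \<le> (1 :: real) / 2"
  proof -
    have "exp 1 \<le> pi" using exp_le pi_gt3 by linarith
    then show ?thesis by (simp add: field_simps)
  qed
  moreover have "0 \<le> p\<^sup>2 / (B\<^sup>2 * r ^ 3)" using r by simp
  ultimately have "cmod (perron_kernel x B t) \<le> 1 / 2 * (4 / (v * (1 + B\<^sup>2 / 16 * v\<^sup>2)))"
    by (metis mult_mono divide_nonneg_nonneg zero_le_one zero_le_numeral)
  then show ?thesis by (simp add: v_def)
qed

section \<open>The weights of the smoothed sums\<close>

locale perron =
  fixes x B :: real
  assumes B: "0 < B" "2 * B \<le> x"
begin

lemma x: "0 < x" using B by linarith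

sublocale line_kernel "perron_kernel x B"
proof
  have "continuous_on UNIV (\<lambda>t. perron_factor B (Complex (1 / x) t))"
    by (rule continuous_on_compose2[OF holomorphic_on_imp_continuous_on[OF perron_factor_holomorphic[of B "UNIV - {0}"]]])
       (use B x in \<open>auto intro!: continuous_intros simp: complex_eq_iff Complex_eq\<close>)
  then show "continuous_on UNIV (perron_kernel x B)"
    unfolding perron_kernel_def by (auto intro!: continuous_intros simp: Complex_eq)
  then have [measurable]: "perron_kernel x B \<in> borel_measurable borel"
    by (rule borel_measurable_continuous_onI)
  show "integrable lborel (\<lambda>t. (1 + \<bar>t\<bar>) * cmod (perron_kernel x B t))"
  proof (rule Bochner_Integration.integrable_bound)
    show "integrable lborel (\<lambda>t. (1 + x) * 32 / B\<^sup>2 * (1 / (1 / x + \<bar>t\<bar>)\<^sup>2))"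
      by (intro integrable_mult_right integrable_inverse_square) (use x in auto)
    show "AE t in lborel. norm ((1 + \<bar>t\<bar>) * cmod (perron_kernel x B t))
        \<le> norm ((1 + x) * 32 / B\<^sup>2 * (1 / (1 / x + \<bar>t\<bar>)\<^sup>2))"
    proof (rule AE_I2)
      fix t :: real
      define v where "v = 1 / x + \<bar>t\<bar>"
      have v: "0 < v" using x by (simp add: v_def add_pos_nonneg)
      \<comment> \<open>The first moment costs one power of v, so the cubic decay becomes the
        integrable v^{-2}.\<close>
      have t: "1 + \<bar>t\<bar> \<le> (1 + x) * v" using x by (simp add: v_def field_simps)
      have "cmod (perron_kernel x B t) \<le> 2 * (1 / (v * (1 + B\<^sup>2 / 16 * v\<^sup>2)))"
        using perron_kernel_bound[OF B(1) x] by (simp add: v_def)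
      also have "\<dots> \<le> 2 * (1 / (v * (B\<^sup>2 / 16 * v\<^sup>2)))"
        using v B by (intro mult_left_mono frac_le) (auto intro!: mult_pos_pos)
      finally have "(1 + \<bar>t\<bar>) * cmod (perron_kernel x B t) \<le> (1 + x) * v * (2 * (1 / (v * (B\<^sup>2 / 16 * v\<^sup>2))))"
        using t v x by (intro mult_mono) auto
      also have "\<dots> = (1 + x) * 32 / B\<^sup>2 * (1 / v\<^sup>2)" using v by simp
      finally show "norm ((1 + \<bar>t\<bar>) * cmod (perron_kernel x B t))
          \<le> norm ((1 + x) * 32 / B\<^sup>2 * (1 / (1 / x + \<bar>t\<bar>)\<^sup>2))"
        using x by (simp add: v_def)
    qed
  qed measurable
qed

lemma L1_le: "L1 \<le> 2 * ln (1 + 16 * x\<^sup>2 / B\<^sup>2)"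
proof -
  let ?g = "\<lambda>t. 1 / ((1 / x + \<bar>t\<bar>) * (1 + B\<^sup>2 / 16 * (1 / x + \<bar>t\<bar>)\<^sup>2))"
  have g: "has_bochner_integral lborel ?g (ln (1 + 1 / (B\<^sup>2 / 16 * (1 / x)\<^sup>2)))"
    by (rule integral_log_majorant) (use x B in auto)
  have "L1 \<le> (LINT t|lborel. 2 * ?g t)"
    unfolding L1_def using g integrable_norm perron_kernel_bound[OF B(1) x]
    by (intro integral_mono integrable_mult_right) (auto simp: has_bochner_integral_iff)
  also have "\<dots> = 2 * (LINT t|lborel. ?g t)" by (rule integral_mult_right_zero)
  also have "(LINT t|lborel. ?g t) = ln (1 + 1 / (B\<^sup>2 / 16 * (1 / x)\<^sup>2))"
    by (rule has_bochner_integral_integral_eq[OF g])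
  also have "1 / (B\<^sup>2 / 16 * (1 / x)\<^sup>2) = 16 * x\<^sup>2 / B\<^sup>2" by (simp add: power_divide)
  finally show ?thesis .
qed

text \<open>The exponential undoes the shift of the line of integration to \<open>Re z = 1 / x\<close>.\<close>

definition weight :: "real \<Rightarrow> complex" where
  "weight y = exp (- (of_real y / of_real x)) * transform y"

text \<open>The weight is the average of the single exponential e^{-ys} at s = 1/x. This function is
  bounded by 1 on the half-plane, so the truncation estimate for averages applies and yields the
  limit of contour integrals over growing segments.\<close>

lemma weight_limit:
  assumes "0 \<le> y"
  shows "(\<lambda>n. contour_integral (linepath (Complex (1 / x) (- real n)) (Complex (1 / x) (real n)))
      (\<lambda>z. exp (of_real (x - y) * z) * perron_factor B z)) \<longlonglongrightarrow> 2 * pi * \<i> * weight y"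
proof -
  define G where "G = (\<lambda>z. exp (of_real (x - y) * z) * perron_factor B z)"
  define f where "f = (\<lambda>z::complex. exp (- (of_real y * z)))"
  define I where "I = (\<lambda>n. integral (cbox (- real n) (real n))
    (\<lambda>t. f (of_real (1 / x) + \<i> * of_real t) * perron_kernel x B t))"
  have f: "f holomorphic_on half_plane 0" "\<And>s. 0 < Re s \<Longrightarrow> cmod (f s) \<le> 1"
    using assms by (auto simp: f_def intro!: holomorphic_intros)
  have line: "of_real (1 / x) + \<i> * of_real t = Complex (1 / x) t" for t
    by (simp add: complex_eq_iff)
  have fk: "f (Complex (1 / x) t) * perron_kernel x B t = G (Complex (1 / x) t) / (2 * pi)" for t
    by (simp add: f_def perron_kernel_def G_def mult.assoc left_diff_distrib flip: exp_add)
  have avg: "average f (of_real (1 / x)) = weight y"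
  proof -
    have "f (of_real (1 / x) + \<i> * of_real t) = exp (- (of_real y / of_real x)) * exp (- (of_real y * (\<i> * of_real t)))" for t
      by (simp add: f_def ring_distribs flip: exp_add)
    then show ?thesis
      by (simp add: average_def weight_def transform_def mult.assoc)
  qed
  have "(\<lambda>n. average f (of_real (1 / x)) - I n) \<longlonglongrightarrow> 0"
  proof (rule Lim_null_comparison[OF _ tail_tendsto])
    have "cmod (average f (of_real (1 / x)) - I n) \<le> 1 * tail n" for n
      unfolding I_def by (rule average_truncated[OF f]) (use x in auto)
    then show "\<forall>\<^sub>F n in sequentially. cmod (average f (of_real (1 / x)) - I n) \<le> tail n" by simp
  qed
  then have "(\<lambda>n. weight y - I n) \<longlonglongrightarrow> 0" by (simp only: avg)
  from tendsto_diff[OF tendsto_const[of "weight y"] this] have "I \<longlonglongrightarrow> weight y" by simp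
  then have "(\<lambda>n. 2 * pi * \<i> * I n) \<longlonglongrightarrow> 2 * pi * \<i> * weight y" by (intro tendsto_intros)
  moreover have "\<forall>\<^sub>F n in sequentially. 2 * pi * \<i> * I n =
    contour_integral (linepath (Complex (1 / x) (- real n)) (Complex (1 / x) (real n))) G"
    using eventually_gt_at_top[of 0]
  proof eventually_elim
    case (elim n)
    have "I n = integral {- real n..real n} (\<lambda>t. G (Complex (1 / x) t) / (2 * pi))"
      by (simp only: I_def line fk cbox_interval)
    also have "\<dots> = integral {- real n..real n} (\<lambda>t. G (Complex (1 / x) t)) / (2 * pi)"
      by simp
    finally show ?case
      using contour_integral_linepath_same_Re[of "Complex (1 / x) (- real n)" "1 / x" "Complex (1 / x) (real n)" "- real n" "real n" G] elim
      by simp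
  qed
  ultimately show ?thesis unfolding G_def by (rule Lim_transform_eventually)
qed

lemma weight_eq_0:
  assumes "x \<le> y" shows "weight y = 0"
proof -
  have y: "0 \<le> y" using assms x by linarith
  have "(\<lambda>n. contour_integral (linepath (Complex (1 / x) (- real n)) (Complex (1 / x) (real n)))
      (\<lambda>z. exp (of_real (x - y) * z) * perron_factor B z)) \<longlonglongrightarrow> 0"
  proof (rule Lim_null_comparison)
    show "(\<lambda>n. 16 / (B\<^sup>2 * (real n)\<^sup>2)) \<longlonglongrightarrow> 0" using B by real_asymp
    obtain N where N: "1 / x < real N" using reals_Archimedean2 by blast
    show "\<forall>\<^sub>F n in sequentially. cmod (contour_integral (linepath (Complex (1 / x) (- real n)) (Complex (1 / x) (real n)))
      (\<lambda>z. exp (of_real (x - y) * z) * perron_factor B z)) \<le> 16 / (B\<^sup>2 * (real n)\<^sup>2)"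
      using eventually_ge_at_top[of N]
    proof eventually_elim
      case (elim n)
      have "- (of_real (y - x) * z) = of_real (x - y) * z" for z :: complex by (simp add: algebra_simps)
      moreover have "1 / x < real n" using N elim by linarith
      ultimately show ?case using perron_integral_tail[of B "1 / x" "real n" "y - x"] B x assms by simp
    qed
  qed
  from LIMSEQ_unique[OF weight_limit[OF y] this] show ?thesis by simp
qed

text \<open>The contour estimate is used with x - y in place of y; its error is O(T^{-2}) as the
  segment grows.\<close>

lemma weight_eq_1:
  assumes "0 \<le> y" "y \<le> x - 2 * B" shows "weight y = 1"
proof -
  define A where "A = 6 * exp ((x - y - 2 * B) * (1 / x)) * (exp (B * (1 / x)) + 1)\<^sup>2"
  have "(\<lambda>n. contour_integral (linepath (Complex (1 / x) (- real n)) (Complex (1 / x) (real n)))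
      (\<lambda>z. exp (of_real (x - y) * z) * perron_factor B z) - 2 * pi * \<i>) \<longlonglongrightarrow> 0"
  proof (rule Lim_null_comparison)
    show "(\<lambda>n. A / (B\<^sup>2 * (real n)\<^sup>2)) \<longlonglongrightarrow> 0" using B by real_asymp
    obtain N where N: "1 / x < real N" using reals_Archimedean2 by blast
    show "\<forall>\<^sub>F n in sequentially. cmod (contour_integral (linepath (Complex (1 / x) (- real n)) (Complex (1 / x) (real n)))
      (\<lambda>z. exp (of_real (x - y) * z) * perron_factor B z) - 2 * pi * \<i>) \<le> A / (B\<^sup>2 * (real n)\<^sup>2)"
      using eventually_ge_at_top[of N]
    proof eventually_elim
      case (elim n)
      then have "1 / x < real n" using N by linarith
      then show ?case
        unfolding A_def using B x assms by (intro perron_integral_main) auto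
    qed
  qed
  from LIMSEQ_unique[OF weight_limit[OF assms(1)] LIM_zero_cancel[OF this]] show ?thesis by simp
qed

text \<open>The bound for \<open>transform\<close> is applied at 1/x + s. The factor
  e^{-\<lambda>/x} of each term there cancels the e^{\<lambda>/x} contained in
  \<open>transform\<close>; this leaves \<open>weight\<close> and lets s reach the imaginary
  axis.\<close>

lemma weighted_sum_bound:
  assumes fr: "frequency lam" and conv: "dconv lam a s0"
    and hol: "f holomorphic_on half_plane 0" and bd: "\<And>s. 0 < Re s \<Longrightarrow> cmod (f s) \<le> M"
    and eq: "\<And>s. R < Re s \<Longrightarrow> f s = dsum lam a s"
    and N: "x \<le> lam N" and "0 \<le> Re s"
  shows "cmod (\<Sum>n<N. dterm lam a s n * weight (lam n)) \<le> 2 * M * ln (1 + 16 * x\<^sup>2 / B\<^sup>2)"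
proof -
  have w: "transform y = exp (of_real y / of_real x) * weight y" for y
    by (simp add: weight_def flip: exp_add mult.assoc)
  have "transform (lam n) = 0" if "N \<le> n" for n
  proof -
    have "x \<le> lam n" using N monoD[OF frequency_mono[OF fr] that] by linarith
    then show ?thesis by (simp add: w weight_eq_0)
  qed
  moreover have "0 < Re (of_real (1 / x) + s)" using x \<open>0 \<le> Re s\<close> by (simp add: add_pos_nonneg)
  ultimately have "cmod (\<Sum>n<N. dterm lam a (of_real (1 / x) + s) n * transform (lam n)) \<le> M * L1"
    using smoothed_bound[OF fr conv hol bd eq] by blast
  moreover have "dterm lam a (of_real (1 / x) + s) n * transform (lam n) = dterm lam a s n * weight (lam n)" for n
    unfolding dterm_shift w by (simp add: exp_minus field_simps)
  moreover have "0 \<le> M" using order_trans[OF norm_ge_zero bd[of 1]] by simp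
  then have "M * L1 \<le> M * (2 * ln (1 + 16 * x\<^sup>2 / B\<^sup>2))" by (rule mult_left_mono[OF L1_le])
  ultimately show ?thesis by simp
qed

end

subsection \<open>Dirichlet polynomials\<close>

lemma cesaro_geometric_tendsto_0:
  fixes q :: complex
  assumes "cmod q = 1" "q \<noteq> 1"
  shows "(\<lambda>J. (\<Sum>j<J. q ^ j) / of_nat J) \<longlonglongrightarrow> 0"
proof (rule Lim_null_comparison)
  show "(\<lambda>J. 2 / cmod (1 - q) / real J) \<longlonglongrightarrow> 0" by (rule lim_const_over_n)
  have "cmod ((\<Sum>j<J. q ^ j) / of_nat J) \<le> 2 / cmod (1 - q) / real J" for J
  proof -
    have "cmod (\<Sum>j<J. q ^ j) = cmod (1 - q ^ J) / cmod (1 - q)"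
      using assms(2) by (simp add: sum_gp_strict norm_divide)
    also have "cmod (1 - q ^ J) \<le> 2"
      using norm_triangle_ineq4[of 1 "q ^ J"] assms(1) by (simp add: norm_power)
    finally have "cmod (\<Sum>j<J. q ^ j) \<le> 2 / cmod (1 - q)" by (simp add: divide_right_mono)
    from divide_right_mono[OF this, of "real J"] show ?thesis by (simp add: norm_divide)
  qed
  then show "\<forall>\<^sub>F J in sequentially. cmod ((\<Sum>j<J. q ^ j) / of_nat J) \<le> 2 / cmod (1 - q) / real J"
    by simp
qed

text \<open>The coefficient is the mean value of the polynomial times e^{i \<lambda> t} for its
  frequency \<lambda>. Means over equally spaced samples are used, so that every other term becomes
  a geometric sum.\<close>

lemma dirichlet_polynomial_coefficient_bound:
  fixes lam :: "nat \<Rightarrow> real"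
  assumes lam: "strict_mono lam" "\<And>n. 0 \<le> lam n"
    and bd: "\<And>t. cmod (\<Sum>n<N. c n * exp (- (of_real (lam n) * (\<i> * of_real t)))) \<le> A"
    and m: "m < N"
  shows "cmod (c m) \<le> A"
proof -
  \<comment> \<open>A sampling step this short keeps all phase differences below 1 < 2\<pi> in
    modulus, so distinct frequencies are not aliased.\<close>
  define \<tau> where "\<tau> = 1 / (1 + lam N)"
  define q where "q = (\<lambda>n. exp (\<i> * of_real ((lam m - lam n) * \<tau>)))"
  define P where "P = (\<lambda>t. \<Sum>n<N. c n * exp (- (of_real (lam n) * (\<i> * of_real t))))"
  define avg where "avg = (\<lambda>J. (\<Sum>j<J. exp (of_real (lam m) * (\<i> * of_real (real j * \<tau>))) * P (real j * \<tau>)) / of_nat J)"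
  have q: "cmod (q n) = 1" for n by (simp add: q_def)
  have qm: "q m = 1" by (simp add: q_def)
  have q1: "q n \<noteq> 1" if n: "n < N" "n \<noteq> m" for n
  proof
    define \<theta> where "\<theta> = (lam m - lam n) * \<tau>"
    assume "q n = 1"
    then obtain k :: int where k: "\<theta> = of_int (2 * k) * pi"
      by (auto simp: q_def exp_eq_1 \<theta>_def)
    have "\<bar>lam m - lam n\<bar> < 1 + lam N"
      using strict_monoD[OF lam(1) m] strict_monoD[OF lam(1) n(1)] lam(2)[of m] lam(2)[of n] by auto
    then have "\<bar>\<theta>\<bar> < 1" using lam(2)[of N] by (simp add: \<theta>_def \<tau>_def abs_mult)
    have "lam m \<noteq> lam n" using strict_mono_imp_inj_on[OF lam(1)] n(2) by (auto simp: inj_on_def)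
    then have "\<theta> \<noteq> 0" using lam(2)[of N] by (simp add: \<theta>_def \<tau>_def)
    then have "k \<noteq> 0" using k by auto
    then have "1 \<le> \<bar>real_of_int k\<bar>" by linarith
    then have "2 * pi \<le> \<bar>\<theta>\<bar>" unfolding k by (simp add: abs_mult)
    with \<open>\<bar>\<theta>\<bar> < 1\<close> pi_gt3 show False by linarith
  qed
  have avg_eq: "avg J = (\<Sum>n<N. c n * ((\<Sum>j<J. q n ^ j) / of_nat J))" for J
  proof -
    have "exp (of_real (lam m) * (\<i> * of_real (real j * \<tau>))) * (c n * exp (- (of_real (lam n) * (\<i> * of_real (real j * \<tau>)))))
        = c n * q n ^ j" for j n
    proof -
      have "exp (of_real (lam m) * (\<i> * of_real (real j * \<tau>))) * exp (- (of_real (lam n) * (\<i> * of_real (real j * \<tau>)))) = q n ^ j"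
        unfolding q_def exp_of_nat_mult[symmetric] exp_add[symmetric] by (simp add: algebra_simps)
      then show ?thesis by (metis mult.left_commute)
    qed
    then have "avg J = (\<Sum>j<J. \<Sum>n<N. c n * q n ^ j) / of_nat J"
      unfolding avg_def P_def sum_distrib_left by (simp only:)
    also have "(\<Sum>j<J. \<Sum>n<N. c n * q n ^ j) = (\<Sum>n<N. \<Sum>j<J. c n * q n ^ j)"
      by (rule sum.swap)
    also have "\<dots> / of_nat J = (\<Sum>n<N. c n * ((\<Sum>j<J. q n ^ j) / of_nat J))"
      by (simp only: sum_divide_distrib sum_distrib_left times_divide_eq_right)
    finally show ?thesis .
  qed
  have "avg \<longlonglongrightarrow> (\<Sum>n<N. c n * (if n = m then 1 else 0))"
    unfolding avg_eq
  proof (intro tendsto_intros)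
    fix n assume "n \<in> {..<N}"
    show "(\<lambda>J. (\<Sum>j<J. q n ^ j) / of_nat J) \<longlonglongrightarrow> (if n = m then 1 else 0)"
    proof (cases "n = m")
      case True
      have "\<forall>\<^sub>F J in sequentially. (\<Sum>j<J. q n ^ j) / of_nat J = 1"
        using eventually_gt_at_top[of 0] by eventually_elim (simp add: True qm)
      then show ?thesis using True by (simp add: tendsto_eventually)
    qed (use cesaro_geometric_tendsto_0[OF q q1] \<open>n \<in> {..<N}\<close> in auto)
  qed
  also have "(\<Sum>n<N. c n * (if n = m then 1 else 0)) = (\<Sum>n<N. if n = m then c n else 0)"
    by (rule sum.cong) auto
  also have "\<dots> = c m" using m by simp
  finally have lim: "avg \<longlonglongrightarrow> c m" .
  have A: "0 \<le> A" using order_trans[OF norm_ge_zero bd] .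
  have "cmod (avg J) \<le> A" for J
  proof -
    have "cmod (\<Sum>j<J. exp (of_real (lam m) * (\<i> * of_real (real j * \<tau>))) * P (real j * \<tau>)) \<le> real (card {..<J}) * A"
    proof (rule sum_norm_bound)
      show "cmod (exp (of_real (lam m) * (\<i> * of_real (real j * \<tau>))) * P (real j * \<tau>)) \<le> A" for j
        using bd[of "real j * \<tau>"] by (simp add: norm_mult P_def)
    qed
    then show ?thesis using A by (cases "J = 0") (auto simp: avg_def norm_divide field_simps)
  qed
  then show ?thesis using Lim_bounded[OF tendsto_norm[OF lim]] by blast
qed

text \<open>By Kronecker's theorem some t rotates all terms simultaneously almost onto the positive
  real axis, and there the polynomial is almost the sum of the moduli.\<close>

lemma dirichlet_polynomial_sum_bound:
  assumes indep: "Q_lin_independent lam"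
    and bd: "\<And>t. cmod (\<Sum>n<N. c n * exp (- (of_real (lam n) * (\<i> * of_real t)))) \<le> A"
  shows "(\<Sum>n<N. cmod (c n)) \<le> A"
proof -
  define \<theta> where "\<theta> = (\<lambda>n. lam n / (2 * pi))"
  define \<alpha> where "\<alpha> = (\<lambda>n. Arg (c n) / (2 * pi))"
  define S where "S = (\<Sum>n<N. cmod (c n))"
  have S: "0 \<le> S" by (simp add: S_def sum_nonneg)
  \<comment> \<open>Kronecker's theorem speaks of independence in the reals as a module over the
    integers.\<close>
  interpret int: Modules.module "\<lambda>r. (*) (real_of_int r)"
    by (simp add: Modules.module.intro distrib_left mult.commute)
  have indepD: "q n = 0" if "(\<Sum>n<N. of_rat (q n) * lam n) = 0" "n < N" for q n
    using indep that by (auto simp: Q_lin_independent_def)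
  have inj: "inj_on \<theta> {..<N}"
  proof (rule inj_onI, rule ccontr)
    fix i j assume ij: "i \<in> {..<N}" "j \<in> {..<N}" "\<theta> i = \<theta> j" "i \<noteq> j"
    define q :: "nat \<Rightarrow> rat" where "q = (\<lambda>n. if n = i then 1 else if n = j then - 1 else 0)"
    have "(\<Sum>n<N. of_rat (q n) * lam n) = (\<Sum>n\<in>{i, j}. of_rat (q n) * lam n)"
      by (rule sum.mono_neutral_right) (use ij in \<open>auto simp: q_def\<close>)
    also have "\<dots> = 0" using ij by (simp add: q_def \<theta>_def)
    finally have "q i = 0" using indepD ij by blast
    then show False by (simp add: q_def)
  qed
  have "\<not> int.dependent (\<theta> ` {..<N})"
  proof
    assume "int.dependent (\<theta> ` {..<N})"
    then obtain u v where u: "v \<in> \<theta> ` {..<N}" "u v \<noteq> 0" "(\<Sum>v\<in>\<theta> ` {..<N}. real_of_int (u v) * v) = 0"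
      by (auto simp: int.dependent_finite)
    have "(\<Sum>n<N. of_rat (of_int (u (\<theta> n))) * lam n) = 2 * pi * (\<Sum>n<N. real_of_int (u (\<theta> n)) * \<theta> n)"
      by (simp add: \<theta>_def sum_distrib_left)
    also have "(\<Sum>n<N. real_of_int (u (\<theta> n)) * \<theta> n) = 0"
      using u(3) by (simp add: sum.reindex[OF inj])
    finally have "(\<Sum>n<N. of_rat (of_int (u (\<theta> n))) * lam n) = 0" by simp
    from indepD[OF this] u show False by auto
  qed
  note kronecker = Kronecker_thm_1[OF this inj]
  have approx: "S \<le> A + S * (2 * pi * \<epsilon>)" if \<epsilon>: "0 < \<epsilon>" for \<epsilon>
  proof -
    obtain t h where th: "\<And>n. n < N \<Longrightarrow> \<bar>t * \<theta> n - of_int (h n) - \<alpha> n\<bar> < \<epsilon>"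
      using kronecker[OF \<epsilon>] by blast
    \<comment> \<open>The error, in full turns, of the phase at time t.\<close>
    define \<eta> where "\<eta> = (\<lambda>n. t * \<theta> n - of_int (h n) - \<alpha> n)"
    have rotated: "c n * exp (- (of_real (lam n) * (\<i> * of_real t))) = of_real (cmod (c n)) * exp (\<i> * of_real (- (2 * pi * \<eta> n)))" for n
    proof -
      have "c n = of_real (cmod (c n)) * exp (\<i> * of_real (2 * pi * \<alpha> n))"
        using rcis_cmod_Arg[of "c n"] by (simp add: rcis_def cis_conv_exp \<alpha>_def)
      moreover have "exp (\<i> * of_real (2 * pi * \<alpha> n)) * exp (- (of_real (lam n) * (\<i> * of_real t)))
          = exp (\<i> * of_real (- (2 * pi * \<eta> n))) * exp (- (2 * of_int (h n) * of_real pi * \<i>))"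
        unfolding exp_add[symmetric] by (rule arg_cong[where f = exp]) (simp add: \<eta>_def \<theta>_def algebra_simps)
      moreover have "exp (- (2 * of_int (h n) * of_real pi * \<i>)) = 1"
        using exp_integer_2pi[of "of_int (- h n)"] by (simp add: algebra_simps)
      ultimately show ?thesis by (metis mult.assoc mult.right_neutral)
    qed
    have "cmod (of_real S - (\<Sum>n<N. c n * exp (- (of_real (lam n) * (\<i> * of_real t)))))
        = cmod (\<Sum>n<N. of_real (cmod (c n)) * (1 - exp (\<i> * of_real (- (2 * pi * \<eta> n)))))"
      unfolding rotated S_def by (simp add: sum_subtractf right_diff_distrib)
    also have "\<dots> \<le> (\<Sum>n<N. cmod (c n) * (2 * pi * \<epsilon>))"
    proof (rule sum_norm_le)
      fix n assume "n \<in> {..<N}"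
      then have "\<bar>- (2 * pi * \<eta> n)\<bar> \<le> 2 * pi * \<epsilon>" using th[of n] by (simp add: \<eta>_def abs_mult)
      moreover have "cmod (exp (\<i> * of_real (- (2 * pi * \<eta> n))) - 1) \<le> \<bar>- (2 * pi * \<eta> n)\<bar>"
        unfolding dist_exp_i_1 using abs_sin_x_le_abs_x[of "- (2 * pi * \<eta> n) / 2"] by simp
      ultimately show "cmod (of_real (cmod (c n)) * (1 - exp (\<i> * of_real (- (2 * pi * \<eta> n))))) \<le> cmod (c n) * (2 * pi * \<epsilon>)"
        by (simp add: norm_mult norm_minus_commute mult_left_mono del: of_real_minus)
    qed
    also have "\<dots> = S * (2 * pi * \<epsilon>)" by (simp add: S_def sum_distrib_right)
    finally have "cmod (of_real S) - cmod (\<Sum>n<N. c n * exp (- (of_real (lam n) * (\<i> * of_real t)))) \<le> S * (2 * pi * \<epsilon>)"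
      using norm_triangle_ineq2 order_trans by blast
    with bd[of t] S show ?thesis by simp
  qed
  have "S \<le> A"
  proof (rule field_le_epsilon)
    fix e :: real assume e: "0 < e"
    \<comment> \<open>Dividing by S + 1 rather than S covers the case S = 0.\<close>
    have "2 * pi * (e / (2 * pi * (S + 1))) = e / (S + 1)" by simp
    moreover have "S * (e / (S + 1)) \<le> e" using S e by (simp add: field_simps)
    ultimately have "S * (2 * pi * (e / (2 * pi * (S + 1)))) \<le> e" by simp
    with approx[of "e / (2 * pi * (S + 1))"] S e show "S \<le> A + e" by simp
  qed
  then show ?thesis by (simp add: S_def)
qed

subsection \<open>Series with a bounded limit function\<close>

text \<open>Extension and bound are explicit, so that estimates can be stated as linear in M.
  Agreement with the series is asked only far to the right, which is easy to verify for sums and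
  limits; the identity theorem recovers agreement down to the abscissa of convergence.\<close>

definition bounded_limit ::
  "(nat \<Rightarrow> real) \<Rightarrow> (nat \<Rightarrow> complex) \<Rightarrow> (complex \<Rightarrow> complex) \<Rightarrow> real \<Rightarrow> bool" where
  "bounded_limit lam a f M \<longleftrightarrow> somewhere_convergent lam a \<and> f holomorphic_on half_plane 0 \<and>
     (\<forall>s. 0 < Re s \<longrightarrow> cmod (f s) \<le> M) \<and> (\<exists>R. \<forall>s. R < Re s \<longrightarrow> f s = dsum lam a s)"

lemma bounded_limit_nonneg: "bounded_limit lam a f M \<Longrightarrow> 0 \<le> M"
  unfolding bounded_limit_def by (metis norm_ge_zero order_trans one_complex.sel(1) zero_less_one)

text \<open>The kernel bound \<open>2 ln (1 + 16 x\<^sup>2 / B\<^sup>2)\<close> for \<open>B = x / 4\<close>.\<close>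

definition kernel_const :: real where "kernel_const = 2 * ln 257"

lemma kernel_const_pos: "0 < kernel_const" by (simp add: kernel_const_def)

lemma bounded_limit_weighted_sum:
  assumes fr: "frequency lam" and a: "bounded_limit lam a f M" and "0 < B" "2 * B \<le> x"
    and N: "x \<le> lam N" and s: "0 \<le> Re s"
  shows "cmod (\<Sum>n<N. dterm lam a s n * perron.weight x B (lam n)) \<le> 2 * M * ln (1 + 16 * x\<^sup>2 / B\<^sup>2)"
proof -
  interpret perron x B by standard fact+
  from a obtain s0 R where "dconv lam a s0" "f holomorphic_on half_plane 0"
    "\<And>s. 0 < Re s \<Longrightarrow> cmod (f s) \<le> M" "\<And>s. R < Re s \<Longrightarrow> f s = dsum lam a s"
    by (auto simp: bounded_limit_def somewhere_convergent_def)
  from weighted_sum_bound[OF fr this N s] show ?thesis .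
qed

text \<open>With B proportional to x the logarithm is a constant, so arbitrarily many initial
  coefficients are kept intact at a cost that does not depend on their number.\<close>

lemma bounded_limit_polynomial:
  assumes fr: "frequency lam" and a: "bounded_limit lam a f M"
  shows "\<exists>N' w. N \<le> N' \<and> (\<forall>n<N. w n = 1) \<and>
    (\<forall>t. cmod (\<Sum>n<N'. a n * w n * exp (- (of_real (lam n) * (\<i> * of_real t)))) \<le> kernel_const * M)"
proof -
  \<comment> \<open>With B = x/4 the weight is 1 up to x/2, hence up to \<open>lam N\<close>. The
    maximum keeps x positive when \<open>lam N\<close> is 0.\<close>
  define x where "x = max 1 (2 * lam N)"
  have x1: "1 \<le> x" "2 * lam N \<le> x" by (auto simp: x_def)
  interpret perron x "x / 4" by standard (use x1 in auto)
  have "\<forall>\<^sub>F n in sequentially. x \<le> lam n"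
    using fr by (auto simp: frequency_def filterlim_at_top)
  then obtain N0 where "\<And>n. N0 \<le> n \<Longrightarrow> x \<le> lam n" unfolding eventually_sequentially by blast
  then have N': "x \<le> lam (max N N0)" by simp
  show ?thesis
  proof (intro exI conjI allI impI)
    show "N \<le> max N N0" by simp
    show "weight (lam n) = 1" if "n < N" for n
      using monoD[OF frequency_mono[OF fr], of n N] that x1 fr
      by (intro weight_eq_1) (auto simp: frequency_def)
    fix t
    have "cmod (\<Sum>n<max N N0. dterm lam a (\<i> * of_real t) n * weight (lam n)) \<le> 2 * M * ln (1 + 16 * x\<^sup>2 / (x / 4)\<^sup>2)"
      by (rule bounded_limit_weighted_sum[OF fr a _ _ N']) (use x1 in auto)
    also have "1 + 16 * x\<^sup>2 / (x / 4)\<^sup>2 = 257" using x1 by (simp add: power_divide)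
    finally show "cmod (\<Sum>n<max N N0. a n * weight (lam n) * exp (- (of_real (lam n) * (\<i> * of_real t)))) \<le> kernel_const * M"
      by (simp add: dterm_eq kernel_const_def mult_ac)
  qed
qed

lemma coefficient_bound:
  assumes fr: "frequency lam" and a: "bounded_limit lam a f M"
  shows "cmod (a m) \<le> kernel_const * M"
proof -
  from bounded_limit_polynomial[OF assms, of "Suc m"] obtain N w where
    N: "Suc m \<le> N" "\<And>n. n < Suc m \<Longrightarrow> w n = 1"
      "\<And>t. cmod (\<Sum>n<N. a n * w n * exp (- (of_real (lam n) * (\<i> * of_real t)))) \<le> kernel_const * M"
    by blast
  have "cmod (a m * w m) \<le> kernel_const * M"
    by (rule dirichlet_polynomial_coefficient_bound[OF _ _ N(3)]) (use fr N in \<open>auto simp: frequency_def\<close>)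
  then show ?thesis using N(2) by simp
qed

text \<open>Absolute summability of the coefficients themselves: no growth condition on the
  frequency enters, which is what later permits L = \<infinity>.\<close>

lemma coefficient_sum_bound:
  assumes fr: "frequency lam" and indep: "Q_lin_independent lam" and a: "bounded_limit lam a f M"
  shows "(\<Sum>n<m. cmod (a n)) \<le> kernel_const * M"
proof -
  from bounded_limit_polynomial[OF fr a, of m] obtain N w where
    N: "m \<le> N" "\<And>n. n < m \<Longrightarrow> w n = 1"
      "\<And>t. cmod (\<Sum>n<N. a n * w n * exp (- (of_real (lam n) * (\<i> * of_real t)))) \<le> kernel_const * M"
    by blast
  have "(\<Sum>n<m. cmod (a n)) = (\<Sum>n<m. cmod (a n * w n))" using N(2) by simp
  also have "\<dots> \<le> (\<Sum>n<N. cmod (a n * w n))" by (rule sum_mono2) (use N(1) in auto)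
  also have "\<dots> \<le> kernel_const * M" by (rule dirichlet_polynomial_sum_bound[OF indep N(3)])
  finally show ?thesis .
qed

subsection \<open>Landau's condition\<close>

text \<open>The weight drops from 1 to 0 strictly between consecutive frequencies or up to the next
  one, so smoothing alters no term. The cost is twice the logarithm of x/d up to constants, and
  Landau's condition bounds -ln d by an exponential.\<close>

lemma landau_partial_sums:
  assumes fr: "frequency lam" and lc: "landau_condition lam" and a: "bounded_limit lam a f M" and "0 < \<delta>"
  shows "\<exists>C. \<forall>N. cmod (\<Sum>n\<le>N. a n) \<le> C * exp (\<delta> * lam N)"
proof -
  obtain C0 where C0: "0 < C0" "\<And>n. lam (Suc n) - lam n \<ge> C0 * exp (- exp (\<delta> * lam n))"
    using lc \<open>0 < \<delta>\<close> by (auto simp: landau_condition_def)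
  \<comment> \<open>C \<le> 1 makes C e^{-E} a lower bound for the capped gap \<open>d\<close> as
    well, and -ln C nonnegative.\<close>
  define C where "C = min 1 C0"
  have C: "0 < C" "C \<le> 1" "C \<le> C0" using C0 by (auto simp: C_def)
  \<comment> \<open>Collects ln 65, the bound (2/\<delta>) E for 2 \<open>lam N\<close>, and 2 (E -
    ln C) for -2 ln d, each made a multiple of E by means of E \<ge> 1.\<close>
  define K where "K = ln 65 + 2 / \<delta> + 2 * (1 - ln C)"
  have M: "0 \<le> M" using a by (rule bounded_limit_nonneg)
  have "cmod (\<Sum>n\<le>N. a n) \<le> (2 * M * K) * exp (\<delta> * lam N)" for N
  proof -
    define E where "E = exp (\<delta> * lam N)"
    \<comment> \<open>The cap 1 keeps x below \<open>lam N + 1\<close> when the next gap is large.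
      With B = d/2 the threshold x - 2B is exactly \<open>lam N\<close>.\<close>
    define d where "d = min 1 (lam (Suc N) - lam N)"
    define x where "x = lam N + d"
    have lam: "0 \<le> lam N" "lam N < lam (Suc N)" using fr by (auto simp: frequency_def strict_mono_def)
    have E: "1 \<le> E" using lam \<open>0 < \<delta>\<close> by (simp add: E_def)
    have d: "0 < d" "d \<le> 1" "d \<le> x" "x \<le> lam (Suc N)" "x \<le> lam N + 1"
      using lam by (auto simp: d_def x_def)
    interpret perron x "d / 2" by standard (use d in auto)
    have "C * exp (- E) \<le> d"
    proof -
      have "C * exp (- E) \<le> C0 * exp (- E)" using C by simp
      moreover have "C * exp (- E) \<le> 1 * 1" using C E by (intro mult_mono) auto
      ultimately show ?thesis using C0(2)[of N] unfolding d_def E_def by linarith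
    qed
    then have "ln (C * exp (- E)) \<le> ln d" using C by (intro ln_mono) auto
    then have lnd: "- ln d \<le> E - ln C" using C by (simp add: ln_mult)
    have "weight (lam n) = 1" if "n \<le> N" for n
      using monoD[OF frequency_mono[OF fr] that] fr by (intro weight_eq_1) (auto simp: frequency_def x_def)
    then have "(\<Sum>n\<le>N. a n) = (\<Sum>n<Suc N. dterm lam a 0 n * weight (lam n))"
      by (simp add: dterm_eq lessThan_Suc_atMost)
    also have "cmod \<dots> \<le> 2 * M * ln (1 + 16 * x\<^sup>2 / (d / 2)\<^sup>2)"
      by (rule bounded_limit_weighted_sum[OF fr a]) (use d in auto)
    also have "ln (1 + 16 * x\<^sup>2 / (d / 2)\<^sup>2) \<le> K * E"
    proof -
      \<comment> \<open>This absorbs the summand 1 and produces the constant 65 = 1 + 64.\<close>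
      have "1 \<le> x\<^sup>2 / d\<^sup>2" using d by (simp add: power_mono)
      moreover have "x\<^sup>2 / d\<^sup>2 \<le> (lam N + 1)\<^sup>2 / d\<^sup>2" using d by (intro divide_right_mono power_mono) auto
      moreover have "16 * x\<^sup>2 / (d / 2)\<^sup>2 = 64 * (x\<^sup>2 / d\<^sup>2)" by (simp add: power_divide)
      ultimately have "1 + 16 * x\<^sup>2 / (d / 2)\<^sup>2 \<le> 65 * ((lam N + 1)\<^sup>2 / d\<^sup>2)" by linarith
      moreover have "0 < 1 + 16 * x\<^sup>2 / (d / 2)\<^sup>2" by (intro add_pos_nonneg) auto
      ultimately have "ln (1 + 16 * x\<^sup>2 / (d / 2)\<^sup>2) \<le> ln (65 * ((lam N + 1)\<^sup>2 / d\<^sup>2))"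
        by (intro ln_mono) auto
      also have "\<dots> = ln 65 + 2 * ln (lam N + 1) - 2 * ln d"
        using d lam by (simp add: ln_mult ln_div ln_realpow)
      also have "\<dots> \<le> ln 65 + 2 * lam N + 2 * (E - ln C)"
        using lnd lam ln_add_one_self_le_self[of "lam N"] by (simp add: add.commute)
      also have "\<dots> \<le> ln 65 * E + 2 / \<delta> * E + 2 * (E - ln C * E)"
      proof -
        have "\<delta> * lam N \<le> E" using exp_ge_add_one_self[of "\<delta> * lam N"] unfolding E_def by linarith
        then have "2 * lam N \<le> 2 / \<delta> * E" using \<open>0 < \<delta>\<close> by (simp add: field_simps)
        moreover have "ln (65 :: real) \<le> ln 65 * E" using E by simp
        moreover have "ln C * E \<le> ln C * 1" by (rule mult_left_mono_neg) (use C E in auto)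
        then have "E - ln C \<le> E - ln C * E" by simp
        ultimately show ?thesis by (intro add_mono mult_left_mono) auto
      qed
      also have "\<dots> = K * E" by (simp add: K_def algebra_simps)
      finally show ?thesis .
    qed
    finally show ?thesis using M by (simp add: E_def mult_left_mono mult.assoc)
  qed
  then show ?thesis by blast
qed

lemma landau_convergence:
  assumes fr: "frequency lam" and lc: "landau_condition lam" and a: "bounded_limit lam a f M" and s: "0 < Re s"
  shows "dconv lam a s"
proof -
  obtain C where "\<And>N. cmod (\<Sum>n\<le>N. a n) \<le> C * exp (Re s / 2 * lam N)"
    using landau_partial_sums[OF fr lc a, of "Re s / 2"] s by auto
  then show ?thesis using s by (intro dconv_of_partial_sums[OF fr, of "Re s / 2"]) auto
qed

text \<open>Multiplying the coefficients by e^{-\<lambda>\<sigma>} translates the half-plane to Re s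
  > 0, where the partial sum estimate applies.\<close>

lemma landau_extension_forces_convergence:
  assumes fr: "frequency lam" and lc: "landau_condition lam"
  shows "extension_forces_convergence lam"
  unfolding extension_forces_convergence_def sigma_b_ext_def
proof (intro allI impI Inf_greatest)
  fix a r
  assume sc: "somewhere_convergent lam a" and "r \<in> {ereal \<sigma> |\<sigma>. \<exists>f. bounded_extension lam a \<sigma> f}"
  then obtain \<sigma> f where r: "r = ereal \<sigma>" and f: "bounded_extension lam a \<sigma> f" by blast
  obtain s0 where s0: "dconv lam a s0" using sc by (auto simp: somewhere_convergent_def)
  define b where "b = (\<lambda>n. a n * exp (- (of_real (lam n) * of_real \<sigma>)))"
  define g where "g = (\<lambda>s. f (s + of_real \<sigma>))"
  have b: "dterm lam b s = dterm lam a (s + of_real \<sigma>)" for s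
    by (rule ext) (simp add: b_def dterm_eq ring_distribs exp_diff exp_minus field_simps)
  obtain M where "\<forall>y\<in>f ` half_plane \<sigma>. cmod y \<le> M"
    using f unfolding bounded_extension_def bounded_iff by blast
  then have M: "cmod (f s) \<le> M" if "\<sigma> < Re s" for s using that by simp
  have "bounded_limit lam b g M"
    unfolding bounded_limit_def
  proof (intro conjI)
    have "dconv lam b (s0 - of_real \<sigma>)" using s0 by (simp add: dconv_def b)
    then show "somewhere_convergent lam b" by (auto simp: somewhere_convergent_def)
    have "f \<circ> (\<lambda>s. s + of_real \<sigma>) holomorphic_on half_plane 0"
      by (rule holomorphic_on_compose_gen[where t = "half_plane \<sigma>"])
         (use f in \<open>auto simp: bounded_extension_def intro!: holomorphic_intros\<close>)
    then show "g holomorphic_on half_plane 0" by (simp add: g_def o_def)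
    show "\<forall>s. 0 < Re s \<longrightarrow> cmod (g s) \<le> M" using M by (simp add: g_def)
    have "g s = dsum lam b s" if "max 0 (Re s0 - \<sigma>) < Re s" for s
    proof -
      have "Re s0 < Re (s + of_real \<sigma>)" "\<sigma> < Re (s + of_real \<sigma>)" using that by auto
      moreover have "sigma_c lam a < ereal (Re (s + of_real \<sigma>))"
        using sigma_c_le[OF fr s0] calculation(1) by (meson ereal_less(2) less_ereal.simps(1) order_le_less_trans)
      ultimately show ?thesis using f by (auto simp: bounded_extension_def g_def dsum_def b)
    qed
    then show "\<exists>R. \<forall>s. R < Re s \<longrightarrow> g s = dsum lam b s" by blast
  qed
  then have "dconv lam b (s - of_real \<sigma>)" if "\<sigma> < Re s" for s
    using landau_convergence[OF fr lc] that by simp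
  then have "\<forall>s\<in>half_plane \<sigma>. dconv lam a s" by (simp add: dconv_def b)
  then show "sigma_c lam a \<le> r" unfolding sigma_c_def r by (intro Inf_lower) auto
qed

subsection \<open>The normed spaces\<close>

text \<open>To the right of max 0 \<sigma>, for any \<sigma> beyond which the series converges, both
  f and the sum are holomorphic, so agreement far out propagates to s.\<close>

lemma bounded_limit_imp_extension:
  assumes fr: "frequency lam" and f: "bounded_limit lam a f M"
  shows "bounded_extension lam a 0 f"
  unfolding bounded_extension_def
proof (intro conjI ballI impI)
  show hol: "f holomorphic_on half_plane 0" using f by (simp add: bounded_limit_def)
  show "bounded (f ` half_plane 0)"
    by (rule boundedI[where B = M]) (use f in \<open>auto simp: bounded_limit_def\<close>)
  fix s assume "s \<in> half_plane 0" and s: "sigma_c lam a < ereal (Re s)"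
  from s obtain \<sigma> where "\<forall>z\<in>half_plane \<sigma>. dconv lam a z" "\<sigma> < Re s"
    unfolding sigma_c_def Inf_less_iff by auto
  then have \<sigma>: "\<sigma> < Re z \<Longrightarrow> dconv lam a z" "\<sigma> < Re s" for z by auto
  obtain R where R: "\<And>s. R < Re s \<Longrightarrow> f s = dsum lam a s" using f by (auto simp: bounded_limit_def)
  show "f s = dsum lam a s"
  proof (rule half_plane_identity[where f = f and g = "dsum lam a" and s = s and \<sigma> = "max 0 \<sigma>" and \<tau> = R])
    show "f holomorphic_on half_plane (max 0 \<sigma>)"
      by (rule holomorphic_on_subset[OF hol]) (rule half_plane_mono, simp)
    show "dsum lam a holomorphic_on half_plane (max 0 \<sigma>)"
      by (rule dsum_holomorphic[OF fr]) (use \<sigma> in auto)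
  qed (use R \<sigma> \<open>s \<in> half_plane 0\<close> in auto)
qed

lemma bounded_limit_eq_dsum:
  assumes "frequency lam" "bounded_limit lam a f M" "dconv lam a s0" "Re s0 < Re s" "0 < Re s"
  shows "f s = dsum lam a s"
proof -
  have "sigma_c lam a < ereal (Re s)"
    using sigma_c_le[OF assms(1,3)] assms(4) by (meson less_ereal.simps(1) order_le_less_trans)
  then show ?thesis
    using bounded_limit_imp_extension[OF assms(1,2)] assms(5) by (auto simp: bounded_extension_def)
qed

lemma extension_imp_bounded_limit:
  assumes fr: "frequency lam" and sc: "somewhere_convergent lam a" and f: "bounded_extension lam a 0 f"
    and "\<And>s. 0 < Re s \<Longrightarrow> cmod (f s) \<le> M"
  shows "bounded_limit lam a f M"
  unfolding bounded_limit_def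
proof (intro conjI)
  obtain s0 where s0: "dconv lam a s0" using sc by (auto simp: somewhere_convergent_def)
  have "f s = dsum lam a s" if "max 0 (Re s0) < Re s" for s
  proof -
    have "sigma_c lam a < ereal (Re s)"
      using sigma_c_le[OF fr s0] that by (meson less_ereal.simps(1) max_less_iff_conj order_le_less_trans)
    then show ?thesis using f that by (auto simp: bounded_extension_def)
  qed
  then show "\<exists>R. \<forall>s. R < Re s \<longrightarrow> f s = dsum lam a s" by blast
qed (use assms in \<open>auto simp: bounded_extension_def\<close>)

lemma D_infty_ext_iff:
  assumes "frequency lam"
  shows "a \<in> D_infty_ext lam \<longleftrightarrow> (\<exists>f M. bounded_limit lam a f M)"
proof
  assume "a \<in> D_infty_ext lam"
  then obtain f where f: "somewhere_convergent lam a" "bounded_extension lam a 0 f"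
    by (auto simp: D_infty_ext_def)
  then obtain M where "\<forall>y\<in>f ` half_plane 0. cmod y \<le> M"
    unfolding bounded_extension_def bounded_iff by blast
  then have "bounded_limit lam a f M"
    by (intro extension_imp_bounded_limit[OF assms f]) simp
  then show "\<exists>f M. bounded_limit lam a f M" by blast
next
  assume "\<exists>f M. bounded_limit lam a f M"
  then obtain f M where f: "bounded_limit lam a f M" by blast
  then have "somewhere_convergent lam a" by (simp add: bounded_limit_def)
  with bounded_limit_imp_extension[OF assms f] show "a \<in> D_infty_ext lam"
    unfolding D_infty_ext_def by blast
qed

lemma bounded_limit_unique:
  assumes "bounded_limit lam a f M" "bounded_limit lam a g M'" "0 < Re s"
  shows "f s = g s"
proof -
  obtain R R' where "\<And>s. R < Re s \<Longrightarrow> f s = dsum lam a s" "\<And>s. R' < Re s \<Longrightarrow> g s = dsum lam a s"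
    using assms by (auto simp: bounded_limit_def)
  then show ?thesis
    using assms by (intro half_plane_identity[of f 0 g "max R R'" s]) (auto simp: bounded_limit_def)
qed

lemma D_norm_eq_SUP:
  assumes fr: "frequency lam" and f: "bounded_limit lam a f M"
  shows "D_norm lam a = (SUP s\<in>half_plane 0. cmod (f s))"
proof -
  define g where "g = (SOME g. bounded_extension lam a 0 g)"
  have g: "bounded_extension lam a 0 g"
    unfolding g_def by (rule someI[where x = f]) (rule bounded_limit_imp_extension[OF fr f])
  then obtain M' where "\<forall>y\<in>g ` half_plane 0. cmod y \<le> M'"
    unfolding bounded_extension_def bounded_iff by blast
  then have "bounded_limit lam a g M'"
    by (intro extension_imp_bounded_limit[OF fr _ g]) (use f in \<open>auto simp: bounded_limit_def\<close>)
  then have "g s = f s" if "s \<in> half_plane 0" for s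
    using bounded_limit_unique[OF _ f] that by simp
  then show ?thesis unfolding D_norm_def g_def[symmetric] by (intro SUP_cong) auto
qed

lemma D_norm_le:
  assumes "frequency lam" "bounded_limit lam a f M" shows "D_norm lam a \<le> M"
  unfolding D_norm_eq_SUP[OF assms]
  by (rule cSUP_least) (use assms in \<open>auto simp: half_plane_nonempty bounded_limit_def\<close>)

text \<open>Every estimate linear in M thereby becomes an estimate in the norm.\<close>

lemma bounded_limit_D_norm:
  assumes "frequency lam" "bounded_limit lam a f M" shows "bounded_limit lam a f (D_norm lam a)"
proof -
  have "cmod (f s) \<le> D_norm lam a" if "0 < Re s" for s
    unfolding D_norm_eq_SUP[OF assms]
    by (rule cSUP_upper, use that in simp, rule bdd_aboveI2[where M = M])
       (use assms in \<open>auto simp: bounded_limit_def\<close>)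
  then show ?thesis using assms(2) by (simp add: bounded_limit_def)
qed

lemma bounded_limit_zero: "bounded_limit lam (\<lambda>n. 0) (\<lambda>s. 0) 0"
  by (simp add: bounded_limit_def somewhere_convergent_def dconv_def dsum_def dterm_eq[abs_def])

lemma bounded_limit_add:
  assumes fr: "frequency lam" and a: "bounded_limit lam a f M" and b: "bounded_limit lam b g M'"
  shows "bounded_limit lam (\<lambda>n. a n + b n) (\<lambda>s. f s + g s) (M + M')"
proof -
  obtain s0 s1 where s0: "dconv lam a s0" and s1: "dconv lam b s1"
    using a b by (auto simp: bounded_limit_def somewhere_convergent_def)
  define R where "R = max 0 (max (Re s0) (Re s1))"
  have R: "dconv lam a s \<and> dconv lam b s \<and> f s = dsum lam a s \<and> g s = dsum lam b s" if "R < Re s" for s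
    using that dconv_right[OF fr s0] dconv_right[OF fr s1]
      bounded_limit_eq_dsum[OF fr a s0] bounded_limit_eq_dsum[OF fr b s1] by (auto simp: R_def)
  have dterm: "dterm lam (\<lambda>n. a n + b n) s = (\<lambda>n. dterm lam a s n + dterm lam b s n)" for s
    by (simp add: dterm_eq[abs_def] distrib_right)
  have sum: "dconv lam (\<lambda>n. a n + b n) s \<and> f s + g s = dsum lam (\<lambda>n. a n + b n) s" if "R < Re s" for s
    using R[OF that] by (simp add: dconv_def dsum_def dterm summable_add suminf_add)
  show ?thesis
    unfolding bounded_limit_def
  proof (intro conjI)
    show "somewhere_convergent lam (\<lambda>n. a n + b n)"
      unfolding somewhere_convergent_def by (rule exI[of _ "of_real (R + 1)"]) (simp add: sum)
    show "\<exists>R. \<forall>s. R < Re s \<longrightarrow> f s + g s = dsum lam (\<lambda>n. a n + b n) s"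
      using sum by blast
    show "\<forall>s. 0 < Re s \<longrightarrow> cmod (f s + g s) \<le> M + M'"
      using a b by (auto simp: bounded_limit_def intro: norm_triangle_mono)
  qed (use a b in \<open>auto simp: bounded_limit_def intro!: holomorphic_intros\<close>)
qed

lemma bounded_limit_scale:
  assumes fr: "frequency lam" and a: "bounded_limit lam a f M"
  shows "bounded_limit lam (\<lambda>n. c * a n) (\<lambda>s. c * f s) (cmod c * M)"
proof -
  have dterm: "dterm lam (\<lambda>n. c * a n) s = (\<lambda>n. c * dterm lam a s n)" for s
    by (simp add: dterm_eq[abs_def] mult.assoc)
  obtain s0 where s0: "dconv lam a s0" using a by (auto simp: bounded_limit_def somewhere_convergent_def)
  show ?thesis
    unfolding bounded_limit_def somewhere_convergent_def
  proof (intro conjI)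
    show "\<exists>s. dconv lam (\<lambda>n. c * a n) s"
      using s0 by (auto simp: dconv_def dterm intro: summable_mult)
    have "c * f s = dsum lam (\<lambda>n. c * a n) s" if "max 0 (Re s0) < Re s" for s
      using bounded_limit_eq_dsum[OF fr a s0] dconv_right[OF fr s0, of s] that
      by (simp add: dsum_def dterm dconv_def suminf_mult)
    then show "\<exists>R. \<forall>s. R < Re s \<longrightarrow> c * f s = dsum lam (\<lambda>n. c * a n) s" by blast
  qed (use a in \<open>auto simp: bounded_limit_def norm_mult intro!: holomorphic_intros mult_left_mono\<close>)
qed

lemma bounded_limit_diff:
  assumes fr: "frequency lam" and a: "bounded_limit lam a f M" and b: "bounded_limit lam b g M'"
  shows "bounded_limit lam (\<lambda>n. a n - b n) (\<lambda>s. f s - g s) (M + M')"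
  using bounded_limit_add[OF fr a bounded_limit_scale[OF fr b, of "- 1"]] by simp

lemma D_infty_ext_normed:
  assumes fr: "frequency lam"
  shows "complex_normed_space_on (D_infty_ext lam) (D_norm lam)"
  unfolding complex_normed_space_on_def
proof (intro conjI ballI allI)
  note iff = D_infty_ext_iff[OF fr]
  have zero: "D_norm lam (\<lambda>n. 0) = 0"
    using D_norm_le[OF fr bounded_limit_zero] bounded_limit_nonneg[OF bounded_limit_D_norm[OF fr bounded_limit_zero]]
    by simp
  show "(\<lambda>n. 0) \<in> D_infty_ext lam" using bounded_limit_zero iff by blast
  fix a assume "a \<in> D_infty_ext lam"
  then obtain f where f: "bounded_limit lam a f (D_norm lam a)"
    using iff bounded_limit_D_norm[OF fr] by blast
  show nn: "0 \<le> D_norm lam a" by (rule bounded_limit_nonneg[OF f])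
  show "D_norm lam a = 0 \<longleftrightarrow> a = (\<lambda>n. 0)"
  proof
    assume "D_norm lam a = 0"
    \<comment> \<open>Definiteness is the coefficient estimate at M = 0.\<close>
    then have "cmod (a n) \<le> 0" for n using coefficient_bound[OF fr f, of n] by simp
    then show "a = (\<lambda>n. 0)" by auto
  qed (simp add: zero)
  {
    fix b assume "b \<in> D_infty_ext lam"
    then obtain g where g: "bounded_limit lam b g (D_norm lam b)"
      using iff bounded_limit_D_norm[OF fr] by blast
    show "(\<lambda>n. a n + b n) \<in> D_infty_ext lam" using bounded_limit_add[OF fr f g] iff by blast
    show "D_norm lam (\<lambda>n. a n + b n) \<le> D_norm lam a + D_norm lam b"
      by (rule D_norm_le[OF fr bounded_limit_add[OF fr f g]])
  }
  fix c
  show "(\<lambda>n. c * a n) \<in> D_infty_ext lam" using bounded_limit_scale[OF fr f] iff by blast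
  have le: "D_norm lam (\<lambda>n. c * a n) \<le> cmod c * D_norm lam a"
    by (rule D_norm_le[OF fr bounded_limit_scale[OF fr f]])
  show "D_norm lam (\<lambda>n. c * a n) = cmod c * D_norm lam a"
  proof (cases "c = 0")
    case False
    have "bounded_limit lam (\<lambda>n. c * a n) (\<lambda>s. c * f s) (D_norm lam (\<lambda>n. c * a n))"
      by (rule bounded_limit_D_norm[OF fr bounded_limit_scale[OF fr f]])
    \<comment> \<open>The reverse inequality comes from scaling back by the inverse of c.\<close>
    from D_norm_le[OF fr bounded_limit_scale[OF fr this, of "inverse c"]] False
    have "D_norm lam a \<le> inverse (cmod c) * D_norm lam (\<lambda>n. c * a n)"
      by (simp add: norm_inverse mult.assoc[symmetric])
    with le False show ?thesis by (simp add: field_simps)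
  qed (simp add: zero)
qed

lemma complex_normed_space_onD:
  assumes "complex_normed_space_on V N"
  shows "a \<in> V \<Longrightarrow> b \<in> V \<Longrightarrow> (\<lambda>n. a n + b n) \<in> V"
    and "a \<in> V \<Longrightarrow> b \<in> V \<Longrightarrow> N (\<lambda>n. a n + b n) \<le> N a + N b"
    and "a \<in> V \<Longrightarrow> (\<lambda>n. c * a n) \<in> V"
    and "a \<in> V \<Longrightarrow> N (\<lambda>n. c * a n) = cmod c * N a"
    and "a \<in> V \<Longrightarrow> 0 \<le> N a"
    and "a \<in> V \<Longrightarrow> N a = 0 \<longleftrightarrow> a = (\<lambda>n. 0)"
  using assms by (auto simp: complex_normed_space_on_def)

lemma Metric_space_norm_dist:
  assumes N: "complex_normed_space_on V N"
  shows "Metric_space V (norm_dist V N)"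
proof
  note D = complex_normed_space_onD[OF N]
  have diff: "(\<lambda>n. a n - b n) \<in> V" if "a \<in> V" "b \<in> V" for a b
    using D(1)[OF that(1) D(3)[OF that(2), of "- 1"]] by simp
  show "0 \<le> norm_dist V N a b" for a b
    using D(5)[OF diff] by (simp add: norm_dist_def)
  show "norm_dist V N a b = norm_dist V N b a" for a b
    using D(4)[OF diff, of a b "- 1"] by (auto simp: norm_dist_def)
  show "norm_dist V N a b = 0 \<longleftrightarrow> a = b" if "a \<in> V" "b \<in> V" for a b
    using D(6)[OF diff[OF that]] that by (simp add: norm_dist_def fun_eq_iff)
  show "norm_dist V N a c \<le> norm_dist V N a b + norm_dist V N b c" if "a \<in> V" "b \<in> V" "c \<in> V" for a b c
    using D(2)[OF diff[OF that(1,2)] diff[OF that(2,3)]] that by (simp add: norm_dist_def)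
qed

section \<open>Completeness\<close>

text \<open>\<open>H\<close> embeds the space continuously into a weighted \<ell>^1 space of
  coefficients. A Cauchy sequence then has two limits, of the functions uniformly on Re s > 0 and of
  the coefficients in \<ell>^1, and absolute convergence for Re s > \<sigma> identifies one with the
  sum of the other.\<close>

lemma ext_complete_criterion:
  assumes fr: "frequency lam" and "0 \<le> \<sigma>"
    and H: "\<And>a f M N. bounded_limit lam a f M \<Longrightarrow> (\<Sum>n<N. cmod (a n) * exp (- (\<sigma> * lam n))) \<le> C * M"
  shows "ext_complete lam"
proof -
  let ?V = "D_infty_ext lam" and ?N = "D_norm lam"
  have normed: "complex_normed_space_on ?V ?N" by (rule D_infty_ext_normed[OF fr])
  interpret Metric_space ?V "norm_dist ?V ?N" by (rule Metric_space_norm_dist[OF normed])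
  have conv: "dconv lam a s" if "\<And>N. (\<Sum>n<N. cmod (a n) * exp (- (\<sigma> * lam n))) \<le> B" "\<sigma> \<le> Re s" for a s B
  proof -
    have "summable (\<lambda>n. cmod (a n) * exp (- (\<sigma> * lam n)))"
      by (rule bounded_imp_summable[where B = B]) (use that(1)[of "Suc _"] in \<open>auto simp: lessThan_Suc_atMost\<close>)
    then have "summable (dterm lam a s)"
    proof (rule summable_comparison_test')
      fix n :: nat
      have "\<sigma> * lam n \<le> lam n * Re s"
        using that(2) fr by (simp add: frequency_def mult.commute mult_right_mono)
      then show "cmod (dterm lam a s n) \<le> cmod (a n) * exp (- (\<sigma> * lam n))"
        by (simp add: dterm_eq norm_mult mult_left_mono)
    qed
    then show ?thesis by (simp add: dconv_def)
  qed
  have "\<exists>a. limitin mtopology u a sequentially" if u: "MCauchy u" for u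
  proof -
    have uV: "u j \<in> ?V" for j using u by (auto simp: MCauchy_def)
    then have "\<exists>f. bounded_limit lam (u j) f (?N (u j))" for j
      using D_infty_ext_iff[OF fr] bounded_limit_D_norm[OF fr] by blast
    then obtain F where F: "\<And>j. bounded_limit lam (u j) (F j) (?N (u j))" by metis
    have diff: "bounded_limit lam (\<lambda>n. u j n - u k n) (\<lambda>s. F j s - F k s) (norm_dist ?V ?N (u j) (u k))" for j k
      using bounded_limit_D_norm[OF fr bounded_limit_diff[OF fr F F], of j k] uV by (simp add: norm_dist_def)
    have cauchy: "\<exists>J. \<forall>j k. J \<le> j \<longrightarrow> J \<le> k \<longrightarrow> norm_dist ?V ?N (u j) (u k) < \<epsilon>" if "0 < \<epsilon>" for \<epsilon>
      using u that by (auto simp: MCauchy_def)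
    have "\<forall>\<epsilon>>0. \<exists>J. \<forall>j k s. J \<le> j \<and> J \<le> k \<and> 0 < Re s \<longrightarrow> dist (F j s) (F k s) < \<epsilon>"
    proof (intro allI impI)
      fix \<epsilon> :: real assume "0 < \<epsilon>"
      from cauchy[OF this] obtain J where "\<And>j k. J \<le> j \<Longrightarrow> J \<le> k \<Longrightarrow> norm_dist ?V ?N (u j) (u k) < \<epsilon>" by blast
      moreover have "dist (F j s) (F k s) \<le> norm_dist ?V ?N (u j) (u k)" if "0 < Re s" for j k s
        using diff[of j k] that by (simp add: bounded_limit_def dist_norm)
      ultimately show "\<exists>J. \<forall>j k s. J \<le> j \<and> J \<le> k \<and> 0 < Re s \<longrightarrow> dist (F j s) (F k s) < \<epsilon>"
        by (meson order_le_less_trans)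
    qed
    then obtain f where f: "\<And>\<epsilon>. 0 < \<epsilon> \<Longrightarrow> \<exists>J. \<forall>j s. J \<le> j \<and> 0 < Re s \<longrightarrow> dist (F j s) (f s) < \<epsilon>"
      using uniformly_convergent_eq_cauchy[of "\<lambda>s. 0 < Re s" F] by blast
    have coeff: "cmod (u j n - u k n) * exp (- (\<sigma> * lam n)) \<le> C * norm_dist ?V ?N (u j) (u k)" for j k n
    proof -
      have "cmod (u j n - u k n) * exp (- (\<sigma> * lam n)) \<le> (\<Sum>i<Suc n. cmod (u j i - u k i) * exp (- (\<sigma> * lam i)))"
        by (rule member_le_sum[of n "{..<Suc n}" "\<lambda>i. cmod (u j i - u k i) * exp (- (\<sigma> * lam i))"]) auto
      also have "\<dots> \<le> C * norm_dist ?V ?N (u j) (u k)" by (rule H[OF diff])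
      finally show ?thesis .
    qed
    have small: "\<exists>J. \<forall>j k. J \<le> j \<longrightarrow> J \<le> k \<longrightarrow> C * norm_dist ?V ?N (u j) (u k) \<le> \<epsilon>" if "0 < \<epsilon>" for \<epsilon>
    proof -
      \<comment> \<open>The sign of C is left open; |C| + 1 dominates it and is a positive
        divisor.\<close>
      have "0 < \<epsilon> / (\<bar>C\<bar> + 1)" using that by simp
      then obtain J where J: "\<And>j k. J \<le> j \<Longrightarrow> J \<le> k \<Longrightarrow> norm_dist ?V ?N (u j) (u k) < \<epsilon> / (\<bar>C\<bar> + 1)"
        using cauchy by meson
      have "C * norm_dist ?V ?N (u j) (u k) \<le> \<epsilon>" if "J \<le> j" "J \<le> k" for j k
      proof -
        have "C * norm_dist ?V ?N (u j) (u k) \<le> (\<bar>C\<bar> + 1) * (\<epsilon> / (\<bar>C\<bar> + 1))"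
          by (rule mult_mono) (use J[OF that] in \<open>auto intro: less_imp_le\<close>)
        then show ?thesis by simp
      qed
      then show ?thesis by blast
    qed
    have "Cauchy (\<lambda>j. u j n)" for n
    proof (rule metric_CauchyI)
      fix \<epsilon> :: real assume "0 < \<epsilon>"
      then have "0 < \<epsilon> / 2 * exp (- (\<sigma> * lam n))" by simp
      from small[OF this] obtain J where
        J: "\<And>j k. J \<le> j \<Longrightarrow> J \<le> k \<Longrightarrow> C * norm_dist ?V ?N (u j) (u k) \<le> \<epsilon> / 2 * exp (- (\<sigma> * lam n))" by blast
      have "dist (u j n) (u k n) < \<epsilon>" if "J \<le> j" "J \<le> k" for j k
      proof -
        have "cmod (u j n - u k n) * exp (- (\<sigma> * lam n)) \<le> \<epsilon> / 2 * exp (- (\<sigma> * lam n))"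
          using coeff[of j n k] J[OF that] by linarith
        then have "cmod (u j n - u k n) \<le> \<epsilon> / 2" by simp
        then show ?thesis using \<open>0 < \<epsilon>\<close> by (simp add: dist_norm)
      qed
      then show "\<exists>J. \<forall>j\<ge>J. \<forall>k\<ge>J. dist (u j n) (u k n) < \<epsilon>" by blast
    qed
    then have "\<exists>l. (\<lambda>j. u j n) \<longlonglongrightarrow> l" for n by (simp add: Cauchy_convergent_iff convergent_def)
    then obtain a where a: "\<And>n. (\<lambda>j. u j n) \<longlonglongrightarrow> a n" by metis
    \<comment> \<open>The bound is uniform in N, so letting k tend to infinity in finite sums gives
      convergence in the weighted norm and not merely of each coefficient.\<close>
    have a_diff: "\<exists>J. \<forall>j\<ge>J. \<forall>N. (\<Sum>n<N. cmod (u j n - a n) * exp (- (\<sigma> * lam n))) \<le> \<epsilon>" if "0 < \<epsilon>" for \<epsilon>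
    proof -
      obtain J where J: "\<And>j k. J \<le> j \<Longrightarrow> J \<le> k \<Longrightarrow> C * norm_dist ?V ?N (u j) (u k) \<le> \<epsilon>"
        using small[OF \<open>0 < \<epsilon>\<close>] by blast
      have "(\<Sum>n<N. cmod (u j n - a n) * exp (- (\<sigma> * lam n))) \<le> \<epsilon>" if "J \<le> j" for j N
      proof (rule tendsto_upperbound)
        show "(\<lambda>k. \<Sum>n<N. cmod (u j n - u k n) * exp (- (\<sigma> * lam n)))
            \<longlonglongrightarrow> (\<Sum>n<N. cmod (u j n - a n) * exp (- (\<sigma> * lam n)))"
          by (intro tendsto_intros a)
        show "\<forall>\<^sub>F k in sequentially. (\<Sum>n<N. cmod (u j n - u k n) * exp (- (\<sigma> * lam n))) \<le> \<epsilon>"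
          using eventually_ge_at_top[of J]
        proof eventually_elim
          case (elim k)
          have "(\<Sum>n<N. cmod (u j n - u k n) * exp (- (\<sigma> * lam n))) \<le> C * norm_dist ?V ?N (u j) (u k)"
            by (rule H[OF diff])
          then show ?case using J[OF that elim] by linarith
        qed
      qed simp
      then show ?thesis by blast
    qed
    \<comment> \<open>One member at finite distance from \<open>a\<close> shows that
      \<open>a\<close> itself lies in the weighted space, hence that its series converges at
      \<sigma>.\<close>
    obtain J1 where J1: "\<And>N. (\<Sum>n<N. cmod (u J1 n - a n) * exp (- (\<sigma> * lam n))) \<le> 1"
      using a_diff[of 1] by auto
    have a_sum: "(\<Sum>n<N. cmod (a n) * exp (- (\<sigma> * lam n))) \<le> 1 + C * ?N (u J1)" for N
    proof -
      have "cmod (a n) * exp (- (\<sigma> * lam n))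
          \<le> cmod (u J1 n - a n) * exp (- (\<sigma> * lam n)) + cmod (u J1 n) * exp (- (\<sigma> * lam n))" for n
        unfolding distrib_right[symmetric]
        by (rule mult_right_mono) (use norm_triangle_ineq4[of "u J1 n" "u J1 n - a n"] in auto)
      then have "(\<Sum>n<N. cmod (a n) * exp (- (\<sigma> * lam n)))
          \<le> (\<Sum>n<N. cmod (u J1 n - a n) * exp (- (\<sigma> * lam n)) + cmod (u J1 n) * exp (- (\<sigma> * lam n)))"
        by (rule sum_mono)
      then show ?thesis using J1[of N] H[OF F, of J1 N] by (simp add: sum.distrib)
    qed
    have f_eq: "f s = dsum lam a s" if s: "\<sigma> < Re s" for s
    proof -
      \<comment> \<open>One \<epsilon> for the distance of the functions, one for that of the
        series.\<close>
      have "cmod (f s - dsum lam a s) \<le> 2 * \<epsilon>" if \<epsilon>: "0 < \<epsilon>" for \<epsilon>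
      proof -
        obtain J where J: "\<And>j N. J \<le> j \<Longrightarrow> (\<Sum>n<N. cmod (u j n - a n) * exp (- (\<sigma> * lam n))) \<le> \<epsilon>"
          using a_diff[OF \<epsilon>] by blast
        obtain J' where J': "\<And>j s. J' \<le> j \<Longrightarrow> 0 < Re s \<Longrightarrow> dist (F j s) (f s) < \<epsilon>"
          using f[OF \<epsilon>] by blast
        define j where "j = max J J'"
        have cu: "dconv lam (u j) s" if "\<sigma> \<le> Re s" for s by (rule conv[OF H[OF F] that])
        have ca: "dconv lam a s" by (rule conv[OF a_sum]) (use s in simp)
        have "F j s = dsum lam (u j) s"
          using bounded_limit_eq_dsum[OF fr F cu, of "of_real \<sigma>" s] s \<open>0 \<le> \<sigma>\<close> by simp
        moreover have "cmod (dsum lam (u j) s - dsum lam a s) \<le> \<epsilon>"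
        proof -
          have "(\<lambda>N. \<Sum>n<N. dterm lam (u j) s n - dterm lam a s n) \<longlonglongrightarrow> dsum lam (u j) s - dsum lam a s"
            using sums_diff[OF summable_sums summable_sums] cu[of s] ca s
            by (simp add: dconv_def dsum_def sums_def)
          moreover have "cmod (\<Sum>n<N. dterm lam (u j) s n - dterm lam a s n) \<le> \<epsilon>" for N
          proof -
            have "cmod (dterm lam (u j) s n - dterm lam a s n) \<le> cmod (u j n - a n) * exp (- (\<sigma> * lam n))" for n
            proof -
              have "\<sigma> * lam n \<le> lam n * Re s"
                using s fr by (simp add: frequency_def mult.commute mult_right_mono)
              then have "exp (- (lam n * Re s)) \<le> exp (- (\<sigma> * lam n))" by simp
              moreover have "cmod (dterm lam (u j) s n - dterm lam a s n) = cmod (u j n - a n) * exp (- (lam n * Re s))"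
                by (simp add: dterm_eq norm_mult flip: left_diff_distrib)
              ultimately show ?thesis by (simp add: mult_left_mono)
            qed
            then have "cmod (\<Sum>n<N. dterm lam (u j) s n - dterm lam a s n)
                \<le> (\<Sum>n<N. cmod (u j n - a n) * exp (- (\<sigma> * lam n)))"
              by (intro sum_norm_le)
            also have "\<dots> \<le> \<epsilon>" by (rule J) (simp add: j_def)
            finally show ?thesis .
          qed
          ultimately show ?thesis using Lim_bounded[OF tendsto_norm] by blast
        qed
        moreover have "cmod (F j s - f s) < \<epsilon>" using J'[of j s] s \<open>0 \<le> \<sigma>\<close> by (simp add: j_def dist_norm)
        ultimately show ?thesis
          using norm_triangle_ineq4[of "dsum lam (u j) s - dsum lam a s" "F j s - f s"] by simp
      qed
      from this[of "e / 2" for e] have "cmod (f s - dsum lam a s) \<le> 0 + e" if "0 < e" for e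
        using that by simp
      then have "cmod (f s - dsum lam a s) \<le> 0" by (rule field_le_epsilon)
      then show ?thesis by simp
    qed
    obtain J0 where J0: "\<And>j s. J0 \<le> j \<Longrightarrow> 0 < Re s \<Longrightarrow> dist (F j s) (f s) < 1" using f[of 1] by auto
    have fa: "bounded_limit lam a f (?N (u J0) + 1)"
      unfolding bounded_limit_def
    proof (intro conjI)
      have "dconv lam a (of_real \<sigma>)" by (rule conv[OF a_sum]) simp
      then show "somewhere_convergent lam a" by (auto simp: somewhere_convergent_def)
      show "f holomorphic_on half_plane 0"
      proof (rule holomorphic_uniform_sequence[OF open_half_plane])
        show "F j holomorphic_on half_plane 0" for j using F by (simp add: bounded_limit_def)
        fix s assume "s \<in> half_plane 0"
        then obtain d where d: "0 < d" "cball s d \<subseteq> half_plane 0"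
          using open_half_plane open_contains_cball by blast
        moreover have "uniform_limit (cball s d) F f sequentially"
          unfolding uniform_limit_iff eventually_sequentially
          using f d(2) by (meson half_plane_iff subsetD)
        ultimately show "\<exists>d>0. cball s d \<subseteq> half_plane 0 \<and> uniform_limit (cball s d) F f sequentially" by blast
      qed
      show "\<forall>s. 0 < Re s \<longrightarrow> cmod (f s) \<le> ?N (u J0) + 1"
      proof (intro allI impI)
        fix s :: complex assume s: "0 < Re s"
        have "cmod (F J0 s) \<le> ?N (u J0)" using F[of J0] s by (simp add: bounded_limit_def)
        with J0[of J0 s] s norm_triangle_ineq4[of "F J0 s" "F J0 s - f s"]
        show "cmod (f s) \<le> ?N (u J0) + 1" by (simp add: dist_norm)
      qed
      show "\<exists>R. \<forall>s. R < Re s \<longrightarrow> f s = dsum lam a s" using f_eq by blast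
    qed
    then have aV: "a \<in> ?V" using D_infty_ext_iff[OF fr] by blast
    have "\<exists>J. \<forall>j\<ge>J. u j \<in> ?V \<and> norm_dist ?V ?N (u j) a < \<epsilon>" if "0 < \<epsilon>" for \<epsilon>
    proof -
      have "0 < \<epsilon> / 2" using that by simp
      then obtain J where J: "\<And>j s. J \<le> j \<Longrightarrow> 0 < Re s \<Longrightarrow> dist (F j s) (f s) < \<epsilon> / 2"
        using f by meson
      have "norm_dist ?V ?N (u j) a < \<epsilon>" if "J \<le> j" for j
      proof -
        have "bounded_limit lam (\<lambda>n. u j n - a n) (\<lambda>s. F j s - f s) (\<epsilon> / 2)"
          using bounded_limit_diff[OF fr F fa, of j] J[OF that] by (auto simp: bounded_limit_def dist_norm intro: less_imp_le)
        from D_norm_le[OF fr this] \<open>0 < \<epsilon>\<close> uV aV show ?thesis by (simp add: norm_dist_def)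
      qed
      then show ?thesis using uV by blast
    qed
    then show ?thesis using aV limit_metric_sequentially by blast
  qed
  then have "mcomplete" by (simp add: mcomplete_def)
  then show ?thesis unfolding ext_complete_def banach_space_on_def using normed by blast
qed

lemma D_infty_subset_ext:
  assumes fr: "frequency lam" shows "D_infty lam \<subseteq> D_infty_ext lam"
proof
  fix a assume a: "a \<in> D_infty lam"
  then have conv: "\<And>s. 0 < Re s \<Longrightarrow> dconv lam a s" by (simp add: D_infty_def)
  from a obtain M where "\<forall>y\<in>dsum lam a ` half_plane 0. cmod y \<le> M"
    unfolding D_infty_def bounded_iff by blast
  then have M: "cmod (dsum lam a s) \<le> M" if "0 < Re s" for s using that by simp
  have "bounded_limit lam a (dsum lam a) M"
    unfolding bounded_limit_def somewhere_convergent_def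
    using M conv[of 1] dsum_holomorphic[OF fr conv] by auto
  then show "a \<in> D_infty_ext lam" using D_infty_ext_iff[OF fr] by blast
qed

text \<open>If a bounded extension forces convergence on Re s > 0, the two spaces coincide and
  completeness is inherited.\<close>

lemma D_infty_banach_criterion:
  assumes fr: "frequency lam" and "ext_complete lam"
    and conv: "\<And>a f M s. bounded_limit lam a f M \<Longrightarrow> 0 < Re s \<Longrightarrow> dconv lam a s"
  shows "D_infty_banach lam"
proof -
  have "a \<in> D_infty lam" if a: "a \<in> D_infty_ext lam" for a
  proof -
    obtain f M where f: "bounded_limit lam a f M" using a D_infty_ext_iff[OF fr] by blast
    have "dsum lam a s = f s" if "0 < Re s" for s
      using bounded_limit_eq_dsum[OF fr f conv[OF f, of "of_real (Re s / 2)"], of s] that by simp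
    then have "\<forall>y\<in>dsum lam a ` half_plane 0. cmod y \<le> M" using f by (auto simp: bounded_limit_def)
    then show ?thesis using conv[OF f] by (auto simp: D_infty_def bounded_iff)
  qed
  then have "D_infty lam = D_infty_ext lam" using D_infty_subset_ext[OF fr] by blast
  then show ?thesis using assms(2) by (simp add: D_infty_banach_def ext_complete_def)
qed

subsection \<open>The growth condition\<close>

text \<open>L < c gives ln (n + 1) \<le> c \<open>lam n\<close> eventually, so the terms are
  dominated by (n + 1)^{-2}.\<close>

lemma summable_of_L_freq:
  assumes fr: "frequency lam" and L: "L_freq lam < ereal c" and c: "0 < c"
  shows "summable (\<lambda>n. exp (- (2 * c * lam n)))"
proof (rule summable_comparison_test_ev)
  have "\<forall>\<^sub>F n in sequentially. 1 \<le> lam n"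
    using fr by (auto simp: frequency_def filterlim_at_top)
  moreover have "\<forall>\<^sub>F n in sequentially. ereal (ln (real (Suc n)) / lam n) < ereal c"
    using L unfolding L_freq_def by (rule Limsup_lessD)
  ultimately show "\<forall>\<^sub>F n in sequentially. norm (exp (- (2 * c * lam n))) \<le> inverse (real (Suc n) ^ 2)"
  proof eventually_elim
    case (elim n)
    define k where "k = real (Suc n)"
    have k: "0 < k" by (simp add: k_def)
    have "ln k \<le> c * lam n" using elim by (simp add: k_def field_simps)
    then have "exp (- (2 * c * lam n)) \<le> exp (- (2 * ln k))" by simp
    also have "2 * ln k = ln (k ^ 2)" using k by (simp add: ln_realpow)
    also have "exp (- ln (k ^ 2)) = inverse (k ^ 2)" using k by (simp add: exp_minus)
    finally show ?case by (simp add: k_def)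
  qed
  have "summable (\<lambda>n. inverse (real n ^ 2))"
    using inverse_power_summable[of 2, where 'a = real] by simp
  then show "summable (\<lambda>n. inverse (real (Suc n) ^ 2))"
    using summable_Suc_iff[of "\<lambda>n. inverse (real n ^ 2)"] by blast
qed

lemma ext_complete_of_finite_L:
  assumes fr: "frequency lam" and L: "L_freq lam < \<infinity>"
  shows "ext_complete lam"
proof -
  obtain m :: nat where "L_freq lam < ereal (real m)"
    using L less_PInf_Ex_of_nat by auto
  \<comment> \<open>Passing to m + 1 makes the constant positive.\<close>
  also have "\<dots> < ereal (real (Suc m))" by simp
  finally have sm: "summable (\<lambda>n. exp (- (2 * real (Suc m) * lam n)))"
    by (rule summable_of_L_freq[OF fr]) simp
  define \<sigma> where "\<sigma> = 2 * real (Suc m)"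
  show ?thesis
  proof (rule ext_complete_criterion[OF fr, where \<sigma> = \<sigma> and C = "kernel_const * (\<Sum>n. exp (- (\<sigma> * lam n)))"])
    show "0 \<le> \<sigma>" by (simp add: \<sigma>_def)
    fix a f M N assume a: "bounded_limit lam a f M"
    have KM: "0 \<le> kernel_const * M" using kernel_const_pos bounded_limit_nonneg[OF a] by simp
    have "(\<Sum>n<N. cmod (a n) * exp (- (\<sigma> * lam n))) \<le> (\<Sum>n<N. kernel_const * M * exp (- (\<sigma> * lam n)))"
      by (intro sum_mono mult_right_mono coefficient_bound[OF fr a]) simp
    also have "\<dots> = kernel_const * M * (\<Sum>n<N. exp (- (\<sigma> * lam n)))" by (simp add: sum_distrib_left)
    also have "\<dots> \<le> kernel_const * M * (\<Sum>n. exp (- (\<sigma> * lam n)))"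
      by (rule mult_left_mono[OF sum_le_suminf KM]) (use sm in \<open>auto simp: \<sigma>_def\<close>)
    finally show "(\<Sum>n<N. cmod (a n) * exp (- (\<sigma> * lam n)))
        \<le> kernel_const * (\<Sum>n. exp (- (\<sigma> * lam n))) * M" by (simp add: mult_ac)
  qed
qed

text \<open>Bounded coefficients suffice here: every positive c exceeds L, so c = Re s / 2 gives
  absolute convergence at each s with Re s > 0.\<close>

lemma D_infty_banach_of_L_zero:
  assumes fr: "frequency lam" and L: "L_freq lam = 0"
  shows "D_infty_banach lam"
proof (rule D_infty_banach_criterion[OF fr ext_complete_of_finite_L[OF fr]])
  show "L_freq lam < \<infinity>" using L by simp
  fix a f M s assume a: "bounded_limit lam a f M" and s: "0 < Re s"
  have "summable (\<lambda>n. exp (- (2 * (Re s / 2) * lam n)))"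
    by (rule summable_of_L_freq[OF fr]) (use L s in auto)
  then have "summable (\<lambda>n. kernel_const * M * exp (- (lam n * Re s)))"
    by (intro summable_mult) (simp add: mult.commute)
  then show "dconv lam a s"
    unfolding dconv_def
    by (rule summable_comparison_test')
       (use coefficient_bound[OF fr a] in \<open>simp add: dterm_eq norm_mult mult_right_mono\<close>)
qed

text \<open>The criterion applies with \<sigma> = 0, the plain \<ell>^1 norm of the
  coefficients.\<close>

lemma Q_independent_complete:
  assumes fr: "frequency lam" and indep: "Q_lin_independent lam"
  shows "ext_complete lam" "D_infty_banach lam"
proof -
  show ext: "ext_complete lam"
  proof (rule ext_complete_criterion[OF fr order_refl])
    show "(\<Sum>n<N. cmod (a n) * exp (- (0 * lam n))) \<le> kernel_const * M" if "bounded_limit lam a f M" for a f M N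
      using coefficient_sum_bound[OF fr indep that] by simp
  qed
  show "D_infty_banach lam"
  proof (rule D_infty_banach_criterion[OF fr ext])
    fix a f M s assume a: "bounded_limit lam a f M" and s: "0 < Re s"
    have "summable (\<lambda>n. cmod (a n))"
      by (rule bounded_imp_summable[where B = "kernel_const * M"])
         (use coefficient_sum_bound[OF fr indep a, of "Suc _"] in \<open>auto simp: lessThan_Suc_atMost\<close>)
    then show "dconv lam a s"
      unfolding dconv_def
    proof (rule summable_comparison_test')
      show "cmod (dterm lam a s n) \<le> cmod (a n)" for n
        using s fr by (simp add: dterm_eq norm_mult frequency_def mult_left_le)
    qed
  qed
qed

lemma D_infty_banach_of_forced_convergence:
  assumes fr: "frequency lam" and L: "L_freq lam < \<infinity>" and ec: "extension_forces_convergence lam"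
  shows "D_infty_banach lam"
proof (rule D_infty_banach_criterion[OF fr ext_complete_of_finite_L[OF fr L]])
  fix a f M s assume a: "bounded_limit lam a f M" and s: "0 < Re s"
  have "sigma_b_ext lam a \<le> ereal 0"
    unfolding sigma_b_ext_def using bounded_limit_imp_extension[OF fr a] by (intro Inf_lower) blast
  moreover have "sigma_c lam a \<le> sigma_b_ext lam a"
    using ec a by (simp add: extension_forces_convergence_def bounded_limit_def)
  ultimately have "sigma_c lam a < ereal (Re s)"
    using s by (meson ereal_less(2) less_ereal.simps(1) order_le_less_trans)
  then show "dconv lam a s" by (rule sigma_c_less_dconv)
qed

lemma abscissas_agree_imp: "abscissas_agree lam \<Longrightarrow> extension_forces_convergence lam"
  by (simp add: abscissas_agree_def extension_forces_convergence_def)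

subsection \<open>Bohr's condition\<close>

text \<open>A single exponential of \<lambda> decays more slowly than the double exponential, up to
  a constant factor.\<close>

lemma bohr_imp_landau:
  assumes fr: "frequency lam" and bc: "bohr_condition lam"
  shows "landau_condition lam"
  unfolding landau_condition_def
proof (intro allI impI)
  fix \<delta> :: real assume \<delta>: "0 < \<delta>"
  obtain l where l: "0 < l" "\<And>\<delta>. 0 < \<delta> \<Longrightarrow> \<exists>C>0. \<forall>n. lam (Suc n) - lam n \<ge> C * exp (- (l + \<delta>) * lam n)"
    using bc by (auto simp: bohr_condition_def)
  obtain C where C: "0 < C" "\<And>n. lam (Suc n) - lam n \<ge> C * exp (- (l + 1) * lam n)"
    using l(2)[of 1] by auto
  \<comment> \<open>From completing the square: (l + 1) \<lambda> \<le> (\<delta>\<lambda>)^2 / 2 +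
    D. The square is then below e^{\<delta>\<lambda>} by the quadratic Taylor bound.\<close>
  define D where "D = (l + 1)\<^sup>2 / (2 * \<delta>\<^sup>2)"
  have "C * exp (- D) * exp (- exp (\<delta> * lam n)) \<le> lam (Suc n) - lam n" for n
  proof -
    have lam: "0 \<le> lam n" using fr by (simp add: frequency_def)
    have "(l + 1) * lam n \<le> (\<delta> * lam n)\<^sup>2 / 2 + D"
    proof -
      have "0 \<le> (\<delta> * lam n - (l + 1) / \<delta>)\<^sup>2" by simp
      also have "\<dots> = (\<delta> * lam n)\<^sup>2 - 2 * ((l + 1) * lam n) + 2 * D"
        using \<delta> by (simp add: D_def power2_eq_square field_simps)
      finally show ?thesis by simp
    qed
    also have "(\<delta> * lam n)\<^sup>2 / 2 \<le> exp (\<delta> * lam n)"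
      using exp_lower_Taylor_quadratic[of "\<delta> * lam n"] mult_nonneg_nonneg[of \<delta> "lam n"] lam \<delta> by linarith
    finally have "- D - exp (\<delta> * lam n) \<le> - (l + 1) * lam n" by (simp add: algebra_simps)
    then have "exp (- D - exp (\<delta> * lam n)) \<le> exp (- (l + 1) * lam n)" by simp
    moreover have "exp (- D - exp (\<delta> * lam n)) = exp (- D) * exp (- exp (\<delta> * lam n))"
      by (simp flip: exp_add)
    ultimately have "C * (exp (- D) * exp (- exp (\<delta> * lam n))) \<le> C * exp (- (l + 1) * lam n)"
      using C(1) by (metis mult_left_mono less_imp_le)
    with C(2)[of n] show ?thesis by (simp add: mult.assoc)
  qed
  then show "\<exists>C>0. \<forall>n. C * exp (- exp (\<delta> * lam n)) \<le> lam (Suc n) - lam n"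
    using C(1) by (intro exI[of _ "C * exp (- D)"]) auto
qed

text \<open>The gap bound makes e^{(l + 1)\<lambda>} increase by at least (l + 1) C at each step,
  hence grow at least linearly in n.\<close>

lemma bohr_imp_finite_L:
  assumes fr: "frequency lam" and bc: "bohr_condition lam"
  shows "L_freq lam < \<infinity>"
proof -
  obtain l where l: "0 < l" "\<And>\<delta>. 0 < \<delta> \<Longrightarrow> \<exists>C>0. \<forall>n. lam (Suc n) - lam n \<ge> C * exp (- (l + \<delta>) * lam n)"
    using bc by (auto simp: bohr_condition_def)
  obtain C where C: "0 < C" "\<And>n. lam (Suc n) - lam n \<ge> C * exp (- (l + 1) * lam n)"
    using l(2)[of 1] by auto
  define m where "m = min 1 ((l + 1) * C)"
  have m: "0 < m" "m \<le> 1" "m \<le> (l + 1) * C" using C l by (auto simp: m_def)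
  have grow: "m * real (Suc n) \<le> exp ((l + 1) * lam n)" for n
  proof (induction n)
    case 0
    have "1 \<le> exp ((l + 1) * lam 0)" using fr l by (simp add: frequency_def)
    from order_trans[OF m(2) this] show ?case by simp
  next
    case (Suc n)
    let ?E = "exp ((l + 1) * lam n)"
    have "(l + 1) * (C * exp (- (l + 1) * lam n)) \<le> (l + 1) * (lam (Suc n) - lam n)"
      by (rule mult_left_mono[OF C(2)]) (use l in simp)
    then have "?E * ((l + 1) * (C * exp (- (l + 1) * lam n))) \<le> ?E * ((l + 1) * (lam (Suc n) - lam n))"
      by (rule mult_left_mono) simp
    moreover have "?E * exp (- (l + 1) * lam n) = 1" by (simp add: algebra_simps flip: exp_add)
    then have "?E * ((l + 1) * (C * exp (- (l + 1) * lam n))) = (l + 1) * C" by (simp add: mult_ac)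
    moreover have "?E * (1 + (l + 1) * (lam (Suc n) - lam n)) \<le> ?E * exp ((l + 1) * (lam (Suc n) - lam n))"
      by (intro mult_left_mono exp_ge_add_one_self) simp
    moreover have "?E * exp ((l + 1) * (lam (Suc n) - lam n)) = exp ((l + 1) * lam (Suc n))"
      by (simp add: algebra_simps flip: exp_add)
    moreover have "?E * (1 + (l + 1) * (lam (Suc n) - lam n)) = ?E + ?E * ((l + 1) * (lam (Suc n) - lam n))"
      by (simp add: distrib_left)
    ultimately have "?E + (l + 1) * C \<le> exp ((l + 1) * lam (Suc n))" by linarith
    moreover have "m * real (Suc (Suc n)) = m * real (Suc n) + m" by (simp add: distrib_left)
    ultimately show ?case using Suc m by linarith
  qed
  \<comment> \<open>The 1 makes the denominator positive; -ln m is absorbed by one more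
    \<open>lam n\<close>, whence l + 2.\<close>
  have "\<forall>\<^sub>F n in sequentially. max 1 (- ln m) \<le> lam n"
    using fr unfolding frequency_def filterlim_at_top by blast
  then have "\<forall>\<^sub>F n in sequentially. ereal (ln (real (Suc n)) / lam n) \<le> ereal (l + 2)"
  proof eventually_elim
    case (elim n)
    have "ln (m * real (Suc n)) \<le> ln (exp ((l + 1) * lam n))"
      using grow[of n] m by (intro ln_mono) auto
    then have "ln (real (Suc n)) \<le> (l + 1) * lam n - ln m" using m by (simp add: ln_mult)
    also have "\<dots> \<le> (l + 2) * lam n" using elim by (simp add: algebra_simps)
    finally show ?case using elim by (simp add: field_simps)
  qed
  then have "L_freq lam \<le> ereal (l + 2)" unfolding L_freq_def by (rule Limsup_bounded)
  then show ?thesis by (rule order_le_less_trans) simp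
qed

subsection \<open>Examples\<close>

lemma frequency_nat: "frequency real"
  by (auto simp: frequency_def strict_mono_def filterlim_real_sequentially)

lemma L_freq_nat: "L_freq real = 0"
proof -
  have "(\<lambda>n. ln (real (Suc n)) / real n) \<longlonglongrightarrow> 0" by real_asymp
  then have "(\<lambda>n. ereal (ln (real (Suc n)) / real n)) \<longlonglongrightarrow> ereal 0" by simp
  then show ?thesis
    unfolding L_freq_def using lim_imp_Limsup[OF sequentially_bot] by (metis zero_ereal_def)
qed

lemma not_Q_lin_independent_nat: "\<not> Q_lin_independent real"
proof
  assume "Q_lin_independent real"
  \<comment> \<open>The first frequency is 0, so the coefficient 1 on it alone is a nontrivial
    relation.\<close>
  from this[unfolded Q_lin_independent_def, rule_format, of "\<lambda>_. 1" 1 0] show False by simp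
qed

text \<open>Each term is chosen outside the countable rational span of its predecessors.\<close>

lemma Q_lin_independent_between:
  fixes x :: "nat \<Rightarrow> real"
  assumes "\<And>n. x n < x (Suc n)"
  shows "\<exists>\<mu>. (\<forall>n. x n < \<mu> n \<and> \<mu> n < x (Suc n)) \<and> Q_lin_independent \<mu>"
proof -
  define pick where "pick = (\<lambda>n S. SOME y. y \<in> {x n<..<x (Suc n)} - S)"
  \<comment> \<open>The recursion builds the spans, and the sequence is read off afterwards.
    Starting from {0} keeps the first choice nonzero.\<close>
  define span where "span = rec_nat {0} (\<lambda>n S. (\<lambda>(s, q). s + of_rat q * pick n S) ` (S \<times> UNIV))"
  define \<mu> where "\<mu> = (\<lambda>n. pick n (span n))"
  have span_0: "span 0 = {0}" by (simp add: span_def)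
  have span_Suc: "span (Suc n) = (\<lambda>(s, q). s + of_rat q * \<mu> n) ` (span n \<times> UNIV)" for n
    by (simp add: span_def \<mu>_def)
  have countable: "countable (span n)" for n
    by (induction n) (auto simp: span_0 span_Suc)
  have \<mu>: "\<mu> n \<in> {x n<..<x (Suc n)} - span n" for n
  proof -
    have "\<not> {x n<..<x (Suc n)} \<subseteq> span n"
      using uncountable_open_interval[of "x n" "x (Suc n)"] assms[of n] countable[of n] countable_subset by blast
    then have "\<exists>y. y \<in> {x n<..<x (Suc n)} - span n" by blast
    from someI_ex[OF this] show ?thesis by (simp only: \<mu>_def pick_def)
  qed
  have in_span: "(\<Sum>i<n. of_rat (q i) * \<mu> i) \<in> span n" for n q
  proof (induction n)
    case (Suc n)
    show ?case
      unfolding span_Suc by (rule image_eqI[where x = "(\<Sum>i<n. of_rat (q i) * \<mu> i, q n)"]) (use Suc in auto)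
  qed (simp add: span_0)
  have "\<forall>n<N. q n = 0" if "(\<Sum>n<N. of_rat (q n) * \<mu> n) = 0" for N and q :: "nat \<Rightarrow> rat"
    using that
  proof (induction N)
    case (Suc N)
    have qN: "q N = 0"
    proof (rule ccontr)
      assume "q N \<noteq> 0"
      \<comment> \<open>Solving the relation for its last term would put it into the span that its
        choice avoided.\<close>
      then have "\<mu> N = - (\<Sum>i<N. of_rat (q i) * \<mu> i) / of_rat (q N)"
        using Suc.prems by (simp add: field_simps)
      also have "\<dots> = (\<Sum>i<N. of_rat (- q i / q N) * \<mu> i)"
        by (simp add: of_rat_divide of_rat_minus sum_divide_distrib sum_negf)
      also have "\<dots> \<in> span N" by (rule in_span)
      finally show False using \<mu>[of N] by simp
    qed
    then show ?case using Suc by (auto simp: less_Suc_eq)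
  qed simp
  then have "Q_lin_independent \<mu>" by (simp add: Q_lin_independent_def)
  then show ?thesis using \<mu> by (intro exI[of _ \<mu>]) auto
qed

lemma Q_lin_independent_infinite_L:
  "\<exists>\<mu>. frequency \<mu> \<and> Q_lin_independent \<mu> \<and> L_freq \<mu> = \<infinity>"
proof -
  \<comment> \<open>The square root makes this slower than any multiple of ln n while still
    unbounded; the shift by 2 makes all values positive.\<close>
  define x where "x = (\<lambda>n. sqrt (ln (real n + 2)))"
  have "x n < x (Suc n)" for n by (simp add: x_def)
  from Q_lin_independent_between[of x, OF this] obtain \<mu> where
    \<mu>: "\<And>n. x n < \<mu> n" "\<And>n. \<mu> n < x (Suc n)" "Q_lin_independent \<mu>" by blast
  have pos: "0 < \<mu> n" for n
    using \<mu>(1)[of n] by (rule order_le_less_trans[rotated]) (simp add: x_def)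
  have "frequency \<mu>"
    unfolding frequency_def
  proof (intro conjI allI)
    show "strict_mono \<mu>" using \<mu> by (meson less_trans strict_mono_Suc_iff)
    show "0 \<le> \<mu> n" for n using pos[of n] by simp
    have "filterlim x at_top sequentially" unfolding x_def by real_asymp
    then show "filterlim \<mu> at_top sequentially"
      by (rule filterlim_at_top_mono) (simp add: less_imp_le[OF \<mu>(1)])
  qed
  moreover have "L_freq \<mu> = \<infinity>"
  proof -
    have "filterlim (\<lambda>n. ln (real (Suc n)) / x (Suc n)) at_top sequentially"
      unfolding x_def by real_asymp
    then have "filterlim (\<lambda>n. ln (real (Suc n)) / \<mu> n) at_top sequentially"
    proof (rule filterlim_at_top_mono)
      have "ln (real (Suc n)) / x (Suc n) \<le> ln (real (Suc n)) / \<mu> n" for n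
        using \<mu>(2)[of n] pos[of n] by (intro divide_left_mono) auto
      then show "\<forall>\<^sub>F n in sequentially. ln (real (Suc n)) / x (Suc n) \<le> ln (real (Suc n)) / \<mu> n" by simp
    qed
    then have "(\<lambda>n. ereal (ln (real (Suc n)) / \<mu> n)) \<longlonglongrightarrow> \<infinity>" by (simp add: tendsto_PInfty_eq_at_top)
    then show ?thesis unfolding L_freq_def by (rule lim_imp_Limsup[OF sequentially_bot])
  qed
  ultimately show ?thesis using \<mu>(3) by blast
qed

theorem theorem5p1:
  fixes lam :: "nat \<Rightarrow> real"
  assumes "frequency lam"
  shows
    "(L_freq lam < \<infinity> \<longrightarrow> ext_complete lam) \<and>
     (Q_lin_independent lam \<longrightarrow> D_infty_banach lam) \<and>
     (L_freq lam = 0 \<longrightarrow> D_infty_banach lam) \<and>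
     (abscissas_agree lam \<and> L_freq lam < \<infinity> \<longrightarrow> D_infty_banach lam) \<and>
     (bohr_condition lam \<longrightarrow>
        D_infty_banach lam \<and> extension_forces_convergence lam \<and> L_freq lam < \<infinity>) \<and>
     (landau_condition lam \<and> L_freq lam < \<infinity> \<longrightarrow>
        D_infty_banach lam \<and> extension_forces_convergence lam) \<and>
     (\<exists>\<mu>. frequency \<mu> \<and> ext_complete \<mu> \<and> \<not> L_freq \<mu> < \<infinity>) \<and>
     (\<exists>\<mu>. frequency \<mu> \<and> D_infty_banach \<mu> \<and> \<not> Q_lin_independent \<mu>) \<and>
     (\<exists>\<mu>. frequency \<mu> \<and> D_infty_banach \<mu> \<and> L_freq \<mu> \<noteq> 0) \<and>
     (\<exists>\<mu>. frequency \<mu> \<and> D_infty_banach \<mu> \<and> \<not> (abscissas_agree \<mu> \<and> L_freq \<mu> < \<infinity>)) \<and>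
     (\<exists>\<mu>. frequency \<mu> \<and> D_infty_banach \<mu> \<and> \<not> bohr_condition \<mu>) \<and>
     (\<exists>\<mu>. frequency \<mu> \<and> D_infty_banach \<mu> \<and> \<not> (landau_condition \<mu> \<and> L_freq \<mu> < \<infinity>))"
proof -
  have landau: "D_infty_banach lam \<and> extension_forces_convergence lam"
    if "landau_condition lam" "L_freq lam < \<infinity>"
    using landau_extension_forces_convergence[OF assms that(1)]
      D_infty_banach_of_forced_convergence[OF assms that(2)] by blast
  obtain \<mu> where \<mu>: "frequency \<mu>" "Q_lin_independent \<mu>" "L_freq \<mu> = \<infinity>"
    using Q_lin_independent_infinite_L by blast
  \<comment> \<open>L = \<infinity> violates every condition other than independence; for Bohr's
    condition this is because it would force L < \<infinity>.\<close>
  have "\<not> L_freq \<mu> < \<infinity>" "L_freq \<mu> \<noteq> 0" "\<not> bohr_condition \<mu>"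
    using \<mu> bohr_imp_finite_L[OF \<mu>(1)] by auto
  with Q_independent_complete[OF \<mu>(1,2)] \<mu>(1)
  have witnesses: "\<exists>\<mu>. frequency \<mu> \<and> ext_complete \<mu> \<and> \<not> L_freq \<mu> < \<infinity>"
    "\<exists>\<mu>. frequency \<mu> \<and> D_infty_banach \<mu> \<and> L_freq \<mu> \<noteq> 0"
    "\<exists>\<mu>. frequency \<mu> \<and> D_infty_banach \<mu> \<and> \<not> (abscissas_agree \<mu> \<and> L_freq \<mu> < \<infinity>)"
    "\<exists>\<mu>. frequency \<mu> \<and> D_infty_banach \<mu> \<and> \<not> bohr_condition \<mu>"
    "\<exists>\<mu>. frequency \<mu> \<and> D_infty_banach \<mu> \<and> \<not> (landau_condition \<mu> \<and> L_freq \<mu> < \<infinity>)"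
    by blast+
  have "\<exists>\<mu>. frequency \<mu> \<and> D_infty_banach \<mu> \<and> \<not> Q_lin_independent \<mu>"
    using frequency_nat not_Q_lin_independent_nat D_infty_banach_of_L_zero[OF frequency_nat L_freq_nat] by blast
  then show ?thesis
    using witnesses landau bohr_imp_landau[OF assms] bohr_imp_finite_L[OF assms]
      ext_complete_of_finite_L[OF assms] Q_independent_complete(2)[OF assms] D_infty_banach_of_L_zero[OF assms]
      D_infty_banach_of_forced_convergence[OF assms] abscissas_agree_imp
    by (intro conjI impI) blast+
qed

end
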